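(* Let $Z$ be a random variable with values in $\{2,4,6,\dots\}$ such that $\mu:=\mathbb{E}Z$ satisfies $2<\mu<\infty$, $\mathbb{E}(Z\log Z)<\infty$, and there exists a constant $\zeta\ge 0$ such that $\mathbb{P}(Z-y>z\mid Z>y)\le \mathbb{P}(Z+\zeta>z)$ for all $z$ and all $y\geq 0$ with $\mathbb{P}(Z>y)>0$. Let $X$ be the Canonical Embedded Branching Process (CEBP) with subcrossing number distribution $Z$, as defined in the context, and let $H=\log 2/\log\mu$. Then $X$ is monofractal, in that almost surely the local Hölder exponent satisfies $h_X(t)=H$ for all $t\in[0,1]$.
   Context: Local Hölder exponent. For a process $X$, $h_X(t):=\liminf_{\epsilon\to0}\frac{1}{\log\epsilon}\log\sup_{|u-t|<\epsilon}|X(u)-X(t)|$ (with $u$ ranging over the domain $\mathbb{R}_+$ of $X$). Crossings. Let $X:\mathbb{R}^+\to\mathbb{R}$ be a continuous process with $X(0)=0$. For $n\in\mathbb{Z}$ define the level $n$ passage times by $T^n_0=0$ and $T^n_{k+1}=\inf\{t>T^n_k : X(t)\in 2^n\mathbb{Z},\ X(t)\ne X(T^n_k)\}$ (all assumed finite). The $k$-th level $n$ crossing $C^n_k$ ($k\ge1$) is the piece of sample path from $T^n_{k-1}$ to $T^n_k$; its duration is $D^n_k=T^n_k-T^n_{k-1}$; its orientation is $\alpha^n_k\in\{+,-\}$, with $+$ if $X(T^n_k)-X(T^n_{k-1})=2^n$ and $-$ if it equals $-2^n$. The subcrossings of $C^n_k$ are the level $n-1$ crossings that make it up; $Z^n_k$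 is their number and $A^n_k\in\{+,-\}^{Z^n_k}$ is the vector of their orientations in order. Necessarily $A^n_k$ consists of a number $z\ge0$ of pairs, each equal to $+-$ or $-+$ (excursions), followed by a final pair which is $++$ if $\alpha^n_k=+$ and $--$ if $\alpha^n_k=-$; thus $Z^n_k=2(z+1)$. EBP. $X$ is an Embedded Branching Process (EBP) if for each fixed $n\in\mathbb{Z}$, conditioned on the crossing orientations $\alpha^n_k$, the random variables $A^n_k$ are mutually independent, and $A^n_k$ is conditionally independent of all $A^m_j$ with $m>n$, and moreover, for each $i\in\{+,-\}$, the $\{A^n_k\mid\alpha^n_k=i\}$ are identically distributed. CEBP with subcrossing number distribution $Z$. This is a continuous EBP process $X$ on $\mathbb{R}_+$ with the following properties. (i) The distribution of $Z^n_k$ does not depend on $\alpha^n_k$ and equals that of $Z$; given the number of subcrossings, the excursions are independent and equally likely to be $+-$ or $-+$, i.e. for every $a_+$ made of $z$ pairs (each $+-$ or $-+$) followed by $++$, and every $a_-$ made of $z$ such pairs followed by $--$, $\mathbb{P}(A^n_k=a_+\mid\alpha^n_k=+)=\mathbb{P}(A^n_k=a_-\mid\alpha^n_k=-)=2^{-z}\,\mathbb{P}(Z=2(z+1))$. (ii) For each $n\in\mathbb{Z}$, conditioned on the crossing orientations $\alpha^n_k$, the durations $D^n_k$ are mutually independent, and $D^n_k$ is conditionally independent of all $A^m_j$ with $m>n$. (iii) $D^n_k$ is distributed as $\mu^nW$ (whatever the value of $\alpha^n_k$), where $W$ is the almost sure limit as $m\to\infty$ of $\mu^{-m}N_m$,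 with $(N_m)$ the single-type Galton-Watson process with $N_0=1$ and offspring distribution $Z$ (so $\mathbb{E}W=1$). It is known that such a process exists when $\mu>2$ and $\mathbb{E}(Z\log Z)<\infty$, and that its finite-dimensional distributions are uniquely determined by the law of $Z$. *)

theory Defs
  imports "HOL-Probability.Probability"
begin

section \<open>Local Hoelder exponent\<close>

text \<open>The logarithm is extended by \<open>log 0 = -\<infinity>\<close> and \<open>log \<infinity> = \<infinity>\<close>, so that a path which is
  constant near \<open>t\<close> has exponent \<open>\<infinity>\<close>. Paths are functions on all of \<open>real\<close>, but only their
  values at nonnegative times are ever used.\<close>

definition extended_ln :: "ereal \<Rightarrow> ereal" where
  "extended_ln x = (if x \<le> 0 then -\<infinity> else if x = \<infinity> then \<infinity> else ereal (ln (real_of_ereal x)))"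

definition local_holder_exponent :: "(real \<Rightarrow> real) \<Rightarrow> real \<Rightarrow> ereal" where
  "local_holder_exponent x t =
     Liminf (at_right 0) (\<lambda>\<epsilon>. ereal (1 / ln \<epsilon>) *
       extended_ln (SUP u\<in>{u. 0 \<le> u \<and> \<bar>u - t\<bar> < \<epsilon>}. ereal \<bar>x u - x t\<bar>))"


section \<open>Crossings of a path\<close>

definition next_hits :: "(real \<Rightarrow> real) \<Rightarrow> int \<Rightarrow> real \<Rightarrow> real set" where
  "next_hits x n s = {t. s < t \<and> (\<exists>j::int. x t = of_int j * 2 powi n) \<and> x t \<noteq> x s}"

text \<open>The value in the case of no further hit is irrelevant: all passage times of the processes
  considered below are almost surely finite. Repeating the last passage time merely keeps
  \<open>passage\<close> nonnegative and measurable on the exceptional null set.\<close>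

primrec passage :: "(real \<Rightarrow> real) \<Rightarrow> int \<Rightarrow> nat \<Rightarrow> real" where
  "passage x n 0 = 0"
| "passage x n (Suc k) =
     (if next_hits x n (passage x n k) = {} then passage x n k
      else Inf (next_hits x n (passage x n k)))"

text \<open>The crossings of level \<open>n\<close> are numbered \<open>k = 1, 2, \<dots>\<close>; the functions below are meant
  for \<open>k \<ge> 1\<close> only. The orientations \<open>+\<close> and \<open>-\<close> are \<open>True\<close> and \<open>False\<close>.\<close>

definition duration :: "(real \<Rightarrow> real) \<Rightarrow> int \<Rightarrow> nat \<Rightarrow> real" where
  "duration x n k = passage x n k - passage x n (k - 1)"

definition orientation :: "(real \<Rightarrow> real) \<Rightarrow> int \<Rightarrow> nat \<Rightarrow> bool" where
  "orientation x n k \<longleftrightarrow> x (passage x n k) - x (passage x n (k - 1)) = 2 powi n"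

definition subcrossings :: "(real \<Rightarrow> real) \<Rightarrow> int \<Rightarrow> nat \<Rightarrow> nat set" where
  "subcrossings x n k =
     {j. 1 \<le> j \<and> passage x n (k - 1) \<le> passage x (n - 1) (j - 1)
         \<and> passage x (n - 1) j \<le> passage x n k}"

definition subcrossing_number :: "(real \<Rightarrow> real) \<Rightarrow> int \<Rightarrow> nat \<Rightarrow> nat" where
  "subcrossing_number x n k = card (subcrossings x n k)"

definition subcrossing_orientations :: "(real \<Rightarrow> real) \<Rightarrow> int \<Rightarrow> nat \<Rightarrow> bool list" where
  "subcrossing_orientations x n k =
     map (orientation x (n - 1)) (sorted_list_of_set (subcrossings x n k))"


section \<open>Conditional independence\<close>

text \<open>These follow \<open>prob_space.indep_sets\<close>, \<open>prob_space.indep_set\<close> and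
  \<open>prob_space.indep_vars\<close>, with probabilities replaced by conditional
  probabilities given the sub-\<open>\<sigma>\<close>-algebra \<open>F\<close>.\<close>

definition cond_indep_sets ::
    "'a measure \<Rightarrow> 'a measure \<Rightarrow> ('i \<Rightarrow> 'a set set) \<Rightarrow> 'i set \<Rightarrow> bool" where
  "cond_indep_sets M F E I \<longleftrightarrow>
     (\<forall>i\<in>I. E i \<subseteq> sets M) \<and>
     (\<forall>J\<subseteq>I. J \<noteq> {} \<longrightarrow> finite J \<longrightarrow> (\<forall>B\<in>Pi J E.
        AE \<omega> in M. real_cond_exp M F (indicator (\<Inter>j\<in>J. B j)) \<omega> =
          (\<Prod>j\<in>J. real_cond_exp M F (indicator (B j)) \<omega>)))"

definition cond_indep_set ::
    "'a measure \<Rightarrow> 'a measure \<Rightarrow> 'a set set \<Rightarrow> 'a set set \<Rightarrow> bool" where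
  "cond_indep_set M F A B \<longleftrightarrow> cond_indep_sets M F (case_bool A B) UNIV"

definition cond_indep_vars ::
    "'a measure \<Rightarrow> 'a measure \<Rightarrow> ('i \<Rightarrow> 'b measure) \<Rightarrow> ('i \<Rightarrow> 'a \<Rightarrow> 'b) \<Rightarrow> 'i set \<Rightarrow> bool" where
  "cond_indep_vars M F N Y I \<longleftrightarrow>
     (\<forall>i\<in>I. Y i \<in> measurable M (N i)) \<and>
     cond_indep_sets M F (\<lambda>i. {Y i -` B \<inter> space M | B. B \<in> sets (N i)}) I"

definition generated_by ::
    "'a measure \<Rightarrow> 'b measure \<Rightarrow> ('i \<Rightarrow> 'a \<Rightarrow> 'b) \<Rightarrow> 'i set \<Rightarrow> 'a measure" where
  "generated_by M N Y I =
     vimage_algebra (space M) (\<lambda>\<omega>. \<lambda>i\<in>I. Y i \<omega>) (\<Pi>\<^sub>M i\<in>I. N)"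


section \<open>Galton-Watson processes\<close>

text \<open>\<open>\<xi> (m, i)\<close> is the number of children of the \<open>i\<close>-th individual of generation \<open>m\<close>.\<close>

primrec gw_size :: "(nat \<times> nat \<Rightarrow> nat) \<Rightarrow> nat \<Rightarrow> nat" where
  "gw_size \<xi> 0 = 1"
| "gw_size \<xi> (Suc m) = (\<Sum>i<gw_size \<xi> m. \<xi> (m, i))"

definition gw_space :: "nat pmf \<Rightarrow> (nat \<times> nat \<Rightarrow> nat) measure" where
  "gw_space Z = (\<Pi>\<^sub>M p\<in>UNIV. measure_pmf Z)"

definition pmf_mean :: "nat pmf \<Rightarrow> real" where
  "pmf_mean Z = measure_pmf.expectation Z real"

definition gw_limit :: "nat pmf \<Rightarrow> ((nat \<times> nat \<Rightarrow> nat) \<Rightarrow> real) \<Rightarrow> bool" where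
  "gw_limit Z W \<longleftrightarrow> W \<in> borel_measurable (gw_space Z) \<and>
     (AE \<xi> in gw_space Z. (\<lambda>m. real (gw_size \<xi> m) / pmf_mean Z ^ m) \<longlonglongrightarrow> W \<xi>)"


section \<open>Embedded branching processes\<close>

locale crossing_process = prob_space M
  for M :: "'a measure" +
  fixes X :: "real \<Rightarrow> 'a \<Rightarrow> real"
  assumes random_variable_X: "\<And>t. 0 \<le> t \<Longrightarrow> X t \<in> borel_measurable M"
    and continuous_paths: "\<And>\<omega>. \<omega> \<in> space M \<Longrightarrow> continuous_on {0..} (\<lambda>t. X t \<omega>)"
    and starts_at_0: "\<And>\<omega>. \<omega> \<in> space M \<Longrightarrow> X 0 \<omega> = 0"
    and passage_times_finite:
      "AE \<omega> in M. \<forall>n k. next_hits (\<lambda>t. X t \<omega>) n (passage (\<lambda>t. X t \<omega>) n k) \<noteq> {}"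
begin

abbreviation \<alpha> :: "int \<Rightarrow> nat \<Rightarrow> 'a \<Rightarrow> bool" where
  "\<alpha> n k \<omega> \<equiv> orientation (\<lambda>t. X t \<omega>) n k"

abbreviation D :: "int \<Rightarrow> nat \<Rightarrow> 'a \<Rightarrow> real" where
  "D n k \<omega> \<equiv> duration (\<lambda>t. X t \<omega>) n k"

abbreviation Z_sub :: "int \<Rightarrow> nat \<Rightarrow> 'a \<Rightarrow> nat" where
  "Z_sub n k \<omega> \<equiv> subcrossing_number (\<lambda>t. X t \<omega>) n k"

abbreviation A :: "int \<Rightarrow> nat \<Rightarrow> 'a \<Rightarrow> bool list" where
  "A n k \<omega> \<equiv> subcrossing_orientations (\<lambda>t. X t \<omega>) n k"

definition orientations_algebra :: "int \<Rightarrow> nat set \<Rightarrow> 'a measure" where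
  "orientations_algebra n K = generated_by M (count_space UNIV) (\<lambda>k. \<alpha> n k) K"

definition higher_levels_algebra :: "int \<Rightarrow> 'a measure" where
  "higher_levels_algebra n =
     generated_by M (count_space UNIV) (\<lambda>(m, j). A m j) {(m, j). n < m \<and> 1 \<le> j}"

end

text \<open>Mutual independence is conditional on all level \<open>n\<close> orientations. Independence of a single
  crossing from the higher levels is conditional on the orientation of that crossing: the
  sequence of all level \<open>n\<close> orientations already determines every \<open>A m j\<close> with \<open>m > n\<close>
  (almost surely), so conditioning on the whole sequence would make this requirement void,
  whereas in this form it says that, given the orientations, the law of \<open>A n k\<close>
  depends only on \<open>\<alpha> n k\<close>.\<close>

locale embedded_branching_process = crossing_process +
  assumes A_cond_indep:
      "\<And>n. cond_indep_vars M (orientations_algebra n {1..}) (\<lambda>_. count_space UNIV) (A n) {1..}"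
    and A_cond_indep_higher:
      "\<And>n k. 1 \<le> k \<Longrightarrow> cond_indep_set M (orientations_algebra n {k})
         (sets (generated_by M (count_space UNIV) (A n) {k})) (sets (higher_levels_algebra n))"
    and A_cond_identically_distributed:
      "\<And>n k l i a. \<lbrakk>1 \<le> k; 1 \<le> l;
          \<P>(\<omega> in M. \<alpha> n k \<omega> = i) > 0; \<P>(\<omega> in M. \<alpha> n l \<omega> = i) > 0\<rbrakk> \<Longrightarrow>
         \<P>(\<omega> in M. A n k \<omega> = a \<bar> \<alpha> n k \<omega> = i) = \<P>(\<omega> in M. A n l \<omega> = a \<bar> \<alpha> n l \<omega> = i)"

text \<open>In \<open>cond_A\<close> the list \<open>e\<close> gives the first steps of the successive excursions
  (\<open>True\<close> for \<open>+-\<close> and \<open>False\<close> for \<open>-+\<close>).\<close>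

locale canonical_embedded_branching_process = embedded_branching_process +
  fixes Z :: "nat pmf"
  assumes cond_Z_sub:
      "\<And>n k i m. \<lbrakk>1 \<le> k; \<P>(\<omega> in M. \<alpha> n k \<omega> = i) > 0\<rbrakk> \<Longrightarrow>
         \<P>(\<omega> in M. Z_sub n k \<omega> = m \<bar> \<alpha> n k \<omega> = i) = pmf Z m"
    and cond_A:
      "\<And>n k i e. \<lbrakk>1 \<le> k; \<P>(\<omega> in M. \<alpha> n k \<omega> = i) > 0\<rbrakk> \<Longrightarrow>
         \<P>(\<omega> in M. A n k \<omega> = concat (map (\<lambda>b. [b, \<not> b]) e) @ [i, i] \<bar> \<alpha> n k \<omega> = i)
           = pmf Z (2 * (length e + 1)) / 2 ^ length e"
    and D_cond_indep:
      "\<And>n. cond_indep_vars M (orientations_algebra n {1..}) (\<lambda>_. borel) (D n) {1..}"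
    and D_cond_indep_higher:
      "\<And>n k. 1 \<le> k \<Longrightarrow> cond_indep_set M (orientations_algebra n {k})
         (sets (generated_by M borel (D n) {k})) (sets (higher_levels_algebra n))"
    and D_cond_distributed:
      "\<exists>W. gw_limit Z W \<and>
         (\<forall>n k i B. 1 \<le> k \<and> \<P>(\<omega> in M. \<alpha> n k \<omega> = i) > 0 \<and> B \<in> sets borel \<longrightarrow>
            \<P>(\<omega> in M. D n k \<omega> \<in> B \<bar> \<alpha> n k \<omega> = i)
              = \<P>(\<xi> in gw_space Z. pmf_mean Z powi n * W \<xi> \<in> B))"

end

theory Submission
  imports Defs "HOL-Real_Asymp.Real_Asymp"
begin

text \<open>Write \<open>\<mu>\<close> for the mean of \<open>Z\<close>. A crossing of level \<open>-n\<close> moves the path by \<open>2 powi (-n)\<close> and lasts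
about \<open>\<mu> powi (-n)\<close>. If this were exact up to factors \<open>\<mu> powr (\<plusminus>\<delta> n)\<close>, uniformly over all
crossings that start before time 2, then the oscillation of the path within distance \<open>\<epsilon>\<close> of any
\<open>t\<close> in \<open>[0, 1]\<close> would be \<open>\<epsilon>\<close> to the power \<open>ln 2 / ln \<mu>\<close>, up to an error in the exponent that
vanishes with \<open>\<delta>\<close>: the oscillation cannot be larger because a time interval shorter than every
crossing meets at most two of them, and it cannot be smaller because the crossing that contains
\<open>t\<close> has end points with values at distance \<open>2 powi (-n)\<close>, one of which is far from \<open>X t\<close>. This
deterministic step is \<open>local_holder_exponent_of_regular_durations\<close>.

The uniform control comes from a union bound and the Borel-Cantelli lemma
(\<open>AE_regular_durations\<close>). Only about \<open>\<mu> powi (2 n)\<close> crossings of level \<open>-n\<close> have to be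
controlled: if each of them lasts at least \<open>\<mu> powr (-(1 + \<delta>) n)\<close> with \<open>\<delta> < 1\<close>, then together
they already fill \<open>[0, 2]\<close>. A duration of level \<open>-n\<close> has the law of \<open>\<mu> powi (-n) * W\<close>, so it is
enough that \<open>\<P>(W \<le> v)\<close> and \<open>\<P>(1 / v \<le> W)\<close> decay faster than every power of \<open>v\<close> as
\<open>v\<close> tends to 0.

Left tail (\<open>gw_limit_left_tail\<close>): every individual has at least two children, so the Laplace
transform \<open>\<phi>\<close> of \<open>W\<close> satisfies \<open>\<phi> (\<mu> l) \<le> (\<phi> l)\<^sup>2\<close>. Because \<open>W > 0\<close> almost surely, which holds
because durations are positive, iterating this inequality makes \<open>\<phi>\<close> decay faster than every power.

Right tail (\<open>gw_limit_right_tail\<close>): the tail condition on \<open>Z\<close> makes \<open>Z\<close> exponentially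
integrable (\<open>exponential_moment_of_tail\<close>), and this property passes to \<open>W\<close> by comparing the
generating function of \<open>Z\<close> with a linear fractional one, whose iterates are explicit.\<close>

section \<open>Passage times of a continuous path\<close>

text \<open>On \<open>{s..}\<close> the hits are the preimage of the lattice without the point \<open>x s\<close>, which is a closed
set because the lattice is discrete. The condition \<open>s < t\<close> may be weakened to \<open>s \<le> t\<close>, as the
values at \<open>s\<close> and \<open>t\<close> differ. Hence the infimum that defines the next passage time is attained.\<close>

lemma closed_next_hits:
  assumes cont: "continuous_on {0..} x" and "0 \<le> s"
  shows "closed (next_hits x n s)"
proof -
  let ?S = "of_int ` {j::int. of_int j * 2 powi n \<noteq> x s} :: real set"
  have eq: "next_hits x n s = {s..} \<inter> (\<lambda>t. x t / 2 powi n) -` ?S"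
  proof (intro equalityI subsetI)
    fix t assume "t \<in> next_hits x n s"
    then obtain j :: int where "s < t" "x t = of_int j * 2 powi n" "x t \<noteq> x s"
      by (auto simp: next_hits_def)
    then show "t \<in> {s..} \<inter> (\<lambda>t. x t / 2 powi n) -` ?S"
      by (auto simp: field_simps)
  next
    fix t assume "t \<in> {s..} \<inter> (\<lambda>t. x t / 2 powi n) -` ?S"
    then obtain j :: int where j: "s \<le> t" "x t / 2 powi n = of_int j" "of_int j * 2 powi n \<noteq> x s"
      by auto
    then have "x t = of_int j * 2 powi n"
      by (simp add: field_simps)
    with j show "t \<in> next_hits x n s"
      unfolding next_hits_def by (auto simp: less_le)
  qed
  have "continuous_on {s..} (\<lambda>t. x t / 2 powi n)"
    using \<open>0 \<le> s\<close> by (intro continuous_intros continuous_on_subset[OF cont]) auto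
  then show ?thesis
    unfolding eq by (intro continuous_closed_preimage closed_atLeast closed_of_int_image)
qed

lemma passage_le_Suc: "passage x n k \<le> passage x n (Suc k)"
  by (auto simp: next_hits_def intro!: cInf_greatest)

lemma passage_nonneg: "0 \<le> passage x n k"
proof (induction k)
  case (Suc k)
  then show ?case using passage_le_Suc[of x n k] by linarith
qed simp

lemma duration_Suc: "duration x n (Suc k) = passage x n (Suc k) - passage x n k"
  by (simp add: duration_def del: passage.simps)

context
  fixes x :: "real \<Rightarrow> real" and n :: int
  assumes cont: "continuous_on {0..} x" and start: "x 0 = 0"
    and hits: "\<And>k. next_hits x n (passage x n k) \<noteq> {}"
begin

lemma passage_Suc_hit: "passage x n (Suc k) \<in> next_hits x n (passage x n k)"
proof -
  have "bdd_below (next_hits x n (passage x n k))"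
    by (intro bdd_belowI[of _ "passage x n k"]) (auto simp: next_hits_def)
  then show ?thesis
    using closed_contains_Inf[OF hits _ closed_next_hits[OF cont passage_nonneg]] hits by simp
qed

lemma passage_increasing: "passage x n k < passage x n (Suc k)"
  using passage_Suc_hit[of k] by (simp add: next_hits_def del: passage.simps)

lemma duration_pos: "1 \<le> k \<Longrightarrow> 0 < duration x n k"
  using passage_increasing[of "k - 1"] by (cases k) (simp_all add: duration_Suc del: passage.simps)

lemma passage_on_lattice: "\<exists>j::int. x (passage x n k) = of_int j * 2 powi n"
proof (cases k)
  case 0
  then show ?thesis using start by (intro exI[of _ 0]) simp
next
  case (Suc l)
  then show ?thesis using passage_Suc_hit[of l] by (simp add: next_hits_def del: passage.simps)
qed

lemma crossing_size_ge: "2 powi n \<le> \<bar>x (passage x n (Suc k)) - x (passage x n k)\<bar>"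
proof -
  obtain i j :: int where i: "x (passage x n k) = of_int i * 2 powi n"
    and j: "x (passage x n (Suc k)) = of_int j * 2 powi n"
    using passage_on_lattice by meson
  have "x (passage x n (Suc k)) \<noteq> x (passage x n k)"
    using passage_Suc_hit[of k] by (simp add: next_hits_def del: passage.simps)
  then have "i \<noteq> j" using i j by auto
  then have "1 \<le> \<bar>of_int (j - i) :: real\<bar>" by linarith
  then have "1 * 2 powi n \<le> \<bar>of_int (j - i)\<bar> * (2 powi n :: real)"
    by (intro mult_right_mono) auto
  also have "\<dots> = \<bar>of_int (j - i) * (2 powi n)\<bar>"
    by (simp add: abs_mult)
  finally show ?thesis by (simp add: i j algebra_simps del: passage.simps)
qed

lemma lattice_value_during_crossing:
  assumes "passage x n k < t" "x t = x (passage x n k) + of_int i * 2 powi n" "i \<noteq> 0"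
  shows "passage x n (Suc k) \<le> t"
proof -
  obtain j :: int where "x (passage x n k) = of_int j * 2 powi n"
    using passage_on_lattice by blast
  with assms have "x t = of_int (j + i) * 2 powi n" by (simp add: algebra_simps)
  with assms have "t \<in> next_hits x n (passage x n k)"
    unfolding next_hits_def by (simp, metis)
  moreover have "bdd_below (next_hits x n (passage x n k))"
    by (intro bdd_belowI[of _ "passage x n k"]) (auto simp: next_hits_def)
  ultimately show ?thesis using hits by (simp add: cInf_lower)
qed

text \<open>Otherwise the path would pass one of the two neighbouring lattice points strictly before the
crossing ends, by the intermediate value theorem.\<close>

lemma displacement_during_crossing:
  assumes "passage x n k \<le> t" "t \<le> passage x n (Suc k)"
  shows "\<bar>x t - x (passage x n k)\<bar> \<le> 2 powi n"
proof (rule ccontr)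
  let ?s = "passage x n k" and ?d = "2 powi n :: real"
  assume far: "\<not> ?thesis"
  have cont': "continuous_on {?s..t} x"
    by (rule continuous_on_subset[OF cont]) (use passage_nonneg[of x n k] in auto)
  from far consider "x ?s + ?d < x t" | "x t < x ?s - ?d" by linarith
  then obtain u and i :: int where u: "?s \<le> u" "u \<le> t" "x u = x ?s + of_int i * ?d" "i \<noteq> 0" "u \<noteq> t"
  proof cases
    case 1
    obtain u where "?s \<le> u" "u \<le> t" "x u = x ?s + ?d"
      using IVT'[of x ?s "x ?s + ?d" t, OF _ _ assms(1) cont'] 1 by auto
    with 1 show thesis by (intro that[of u 1]) auto
  next
    case 2
    obtain u where "?s \<le> u" "u \<le> t" "x u = x ?s - ?d"
      using IVT2'[of x t "x ?s - ?d" ?s, OF _ _ assms(1) cont'] 2 by auto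
    with 2 show thesis by (intro that[of u "-1"]) auto
  qed
  then have "?s < u" by (cases "?s = u") auto
  then show False
    using lattice_value_during_crossing[OF _ u(3,4)] u assms by linarith
qed

lemma passage_ge:
  assumes "\<And>k. 1 \<le> k \<Longrightarrow> k \<le> m \<Longrightarrow> l \<le> duration x n k"
  shows "real m * l \<le> passage x n m"
  using assms
proof (induction m)
  case (Suc m)
  have "real m * l \<le> passage x n m" using Suc by simp
  moreover have "l \<le> passage x n (Suc m) - passage x n m"
    using Suc.prems[of "Suc m"] by (simp add: duration_Suc del: passage.simps)
  ultimately show ?case by (simp add: algebra_simps del: passage.simps(2))
qed simp

lemma crossing_at_time:
  assumes "0 \<le> t" "t \<le> passage x n K" "0 < K"
  shows "\<exists>k<K. passage x n k \<le> t \<and> t \<le> passage x n (Suc k)"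
  using assms
proof (induction K)
  case (Suc K)
  show ?case
  proof (cases "t \<le> passage x n K")
    case True
    show ?thesis
    proof (cases "K = 0")
      case True
      then show ?thesis using Suc by (intro exI[of _ 0]) simp
    next
      case False
      then show ?thesis using Suc True less_SucI by (meson not_gr_zero)
    qed
  qed (use Suc in \<open>auto simp del: passage.simps\<close>)
qed simp

text \<open>A time interval shorter than every crossing meets at most two successive crossings, so the path
moves by at most \<open>2 powi n\<close> within each of them and between their starting points. The
bound \<open>T \<le> real K * l\<close> ensures that the first \<open>K\<close> crossings last until time \<open>T\<close>; the additional
one is the successor of the last crossing that starts before \<open>T\<close>.\<close>

lemma oscillation_le:
  assumes long: "\<And>k. 1 \<le> k \<Longrightarrow> k \<le> Suc K \<Longrightarrow> l \<le> duration x n k"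
    and reach: "T \<le> real K * l" "0 < T"
    and times: "0 \<le> s" "s \<le> u" "u \<le> T" "u - s < l"
  shows "\<bar>x u - x s\<bar> \<le> 3 * 2 powi n"
proof -
  have "real K * l \<le> passage x n K" using long by (intro passage_ge) auto
  moreover have "0 < K" using reach by (cases K) auto
  ultimately obtain k where k: "k < K" "passage x n k \<le> s" "s \<le> passage x n (Suc k)"
    using crossing_at_time[of s K] times reach by (auto simp del: passage.simps)
  note s = displacement_during_crossing[OF k(2,3)]
  show ?thesis
  proof (cases "u \<le> passage x n (Suc k)")
    case True
    then have "\<bar>x u - x (passage x n k)\<bar> \<le> 2 powi n"
      using k times by (intro displacement_during_crossing) linarith+
    with s show ?thesis by linarith
  next
    case False
    have "l \<le> duration x n (Suc (Suc k))" using long k by simp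
    then have "u \<le> passage x n (Suc (Suc k))"
      using times k by (simp add: duration_Suc del: passage.simps)
    then have "\<bar>x u - x (passage x n (Suc k))\<bar> \<le> 2 powi n"
      using False by (intro displacement_during_crossing) linarith+
    moreover have "\<bar>x (passage x n (Suc k)) - x (passage x n k)\<bar> \<le> 2 powi n"
      using passage_increasing[of k] by (intro displacement_during_crossing) linarith+
    ultimately show ?thesis using s by linarith
  qed
qed

text \<open>The two ends of the crossing that contains \<open>t\<close> have values at distance at least \<open>2 powi n\<close>, so at one of
them the value is at distance at least \<open>2 powi n / 2\<close> from \<open>x t\<close>.\<close>

lemma oscillation_ge:
  assumes short: "\<And>k. 1 \<le> k \<Longrightarrow> k \<le> K \<Longrightarrow> duration x n k \<le> b"
    and t: "0 \<le> t" "t \<le> passage x n K" "0 < K"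
  shows "\<exists>u\<ge>0. \<bar>u - t\<bar> \<le> b \<and> 2 powi n / 2 \<le> \<bar>x u - x t\<bar>"
proof -
  obtain k where k: "k < K" "passage x n k \<le> t" "t \<le> passage x n (Suc k)"
    using crossing_at_time[OF t] by blast
  have b: "passage x n (Suc k) - passage x n k \<le> b"
    using short[of "Suc k"] k by (simp add: duration_Suc del: passage.simps)
  have "2 powi n / 2 \<le> \<bar>x (passage x n k) - x t\<bar> \<or> 2 powi n / 2 \<le> \<bar>x (passage x n (Suc k)) - x t\<bar>"
    using crossing_size_ge[of k] by linarith
  then show ?thesis
    using b k passage_nonneg[of x n k] passage_nonneg[of x n "Suc k"]
    by (elim disjE) (rule exI, rule conjI, assumption, rule conjI[rotated], assumption, linarith)+
qed

end

section \<open>Local exponent of a path with regular durations\<close>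

lemma extended_ln_mono: "a \<le> b \<Longrightarrow> extended_ln a \<le> extended_ln b"
  by (cases a; cases b) (auto simp: extended_ln_def)

lemma extended_ln_ereal: "0 < s \<Longrightarrow> extended_ln (ereal s) = ereal (ln s)"
  by (simp add: extended_ln_def)

lemma ereal_mult_left_antimono:
  fixes a b :: ereal
  assumes "r < 0" "a \<le> b"
  shows "ereal r * b \<le> ereal r * a"
  using assms by (cases a; cases b) (auto simp: mult_left_mono_neg)

text \<open>As \<open>ln e < 0\<close> for \<open>e < 1\<close>, a lower bound on the oscillation is an upper bound on the quotient
of logarithms, and conversely in the next lemma.\<close>

lemma log_oscillation_le:
  assumes "0 < e" "e < 1" "0 < s" "0 \<le> u" "\<bar>u - t\<bar> < e" "s \<le> \<bar>x u - x t\<bar>"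
  shows "ereal (1 / ln e) * extended_ln (SUP u\<in>{u. 0 \<le> u \<and> \<bar>u - t\<bar> < e}. ereal \<bar>x u - x t\<bar>)
    \<le> ereal (ln s / ln e)"
proof -
  have "ereal s \<le> (SUP u\<in>{u. 0 \<le> u \<and> \<bar>u - t\<bar> < e}. ereal \<bar>x u - x t\<bar>)"
    using assms by (intro SUP_upper2[of u]) auto
  from extended_ln_mono[OF this] have "ereal (1 / ln e) * extended_ln (SUP u\<in>{u. 0 \<le> u \<and> \<bar>u - t\<bar> < e}. ereal \<bar>x u - x t\<bar>)
    \<le> ereal (1 / ln e) * ereal (ln s)"
    using assms by (intro ereal_mult_left_antimono) (auto simp: extended_ln_ereal)
  then show ?thesis by simp
qed

lemma log_oscillation_ge:
  assumes "0 < e" "e < 1" "0 < s" "\<And>u. 0 \<le> u \<Longrightarrow> \<bar>u - t\<bar> < e \<Longrightarrow> \<bar>x u - x t\<bar> \<le> s"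
  shows "ereal (ln s / ln e) \<le>
    ereal (1 / ln e) * extended_ln (SUP u\<in>{u. 0 \<le> u \<and> \<bar>u - t\<bar> < e}. ereal \<bar>x u - x t\<bar>)"
proof -
  have "(SUP u\<in>{u. 0 \<le> u \<and> \<bar>u - t\<bar> < e}. ereal \<bar>x u - x t\<bar>) \<le> ereal s"
    using assms by (intro SUP_least) auto
  from extended_ln_mono[OF this] have "ereal (1 / ln e) * ereal (ln s) \<le>
      ereal (1 / ln e) * extended_ln (SUP u\<in>{u. 0 \<le> u \<and> \<bar>u - t\<bar> < e}. ereal \<bar>x u - x t\<bar>)"
    using assms by (intro ereal_mult_left_antimono) (auto simp: extended_ln_ereal)
  then show ?thesis by simp
qed


text \<open>With \<open>\<delta> = 1 / d\<close>, the control from below of the durations bounds the lower limit from below by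
\<open>ln 2 / ((1 + \<delta>) ln \<mu>)\<close>, and the control from above bounds it from above by
\<open>ln 2 / ((1 - \<delta>) ln \<mu>)\<close>. Both tend to \<open>ln 2 / ln \<mu>\<close> as \<open>d\<close> grows. The number of controlled
crossings is \<open>\<mu> ^ (2 * n)\<close>, rounded up, because this many durations of
\<open>\<mu> powr (-(1 + \<delta>) n)\<close> add up to more than 2 for large \<open>n\<close>; one more is needed for
\<open>oscillation_le\<close>.\<close>

theorem local_holder_exponent_of_regular_durations:
  fixes \<mu> :: real
  assumes cont: "continuous_on {0..} x" and start: "x 0 = 0"
    and hits: "\<And>n k. next_hits x n (passage x n k) \<noteq> {}"
    and \<mu>: "1 < \<mu>"
    and regular: "\<And>d::nat. 2 \<le> d \<Longrightarrow> \<forall>\<^sub>F n in sequentially. \<forall>k\<in>{1..Suc (nat \<lceil>\<mu> ^ (2 * n)\<rceil>)}.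
        \<mu> powr (- (1 + 1 / real d) * real n) \<le> duration x (- int n) k \<and>
        duration x (- int n) k \<le> \<mu> powr (- (1 - 1 / real d) * real n)"
    and t: "t \<in> {0..1}"
  shows "local_holder_exponent x t = ereal (ln 2 / ln \<mu>)"
proof -
  let ?K = "\<lambda>n::nat. nat \<lceil>\<mu> ^ (2 * n)\<rceil>"
  let ?f = "\<lambda>e. ereal (1 / ln e) *
    extended_ln (SUP u\<in>{u. 0 \<le> u \<and> \<bar>u - t\<bar> < e}. ereal \<bar>x u - x t\<bar>)"
  define b where "b = ln \<mu>"
  have b: "0 < b" using \<mu> by (simp add: b_def)
  have powr_b: "\<mu> powr r = exp (r * b)" for r
    using \<mu> by (simp add: powr_def b_def)
  have pow_b: "\<mu> ^ m = exp (m * b)" for m :: nat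
    using \<mu> by (simp add: b_def exp_of_nat_mult)
  have two_powi: "(2::real) powi (- int n) = exp (- real n * ln 2)" for n
    by (simp add: power_int_minus exp_minus exp_of_nat_mult)
  have ln_lattice: "ln (3 * 2 powi (- int n)) = ln 3 - real n * ln 2" for n
    by (simp add: two_powi ln_mult)
  \<comment> \<open>Times up to 2 are relevant: \<open>t \<le> 1\<close>, and only radii below 1 matter.\<close>
  have reach: "\<forall>\<^sub>F n in sequentially. 2 \<le> real (?K n) * \<mu> powr (- (1 + 1 / real d) * real n)"
    if "2 \<le> d" for d :: nat
  proof -
    define c where "c = 1 - 1 / real d"
    have "0 < c" using that by (auto simp: c_def)
    with b have "\<forall>\<^sub>F n::nat in sequentially. 2 \<le> exp (c * b * real n)"
      by real_asymp
    then show ?thesis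
    proof eventually_elim
      case (elim n)
      have "exp (c * b * real n) = \<mu> ^ (2 * n) * \<mu> powr (- (1 + 1 / real d) * real n)"
        by (simp add: pow_b powr_b exp_add[symmetric] c_def algebra_simps)
      also have "\<dots> \<le> real (?K n) * \<mu> powr (- (1 + 1 / real d) * real n)"
        by (intro mult_right_mono) (auto simp: real_nat_ceiling_ge)
      finally show ?case using elim by linarith
    qed
  qed
  have lower_y: "ereal y \<le> Liminf (at_right 0) ?f" if y: "y < ln 2 / b" for y
  proof -
    have "(\<lambda>d::nat. ln 2 / ((1 + 1 / real d) * b)) \<longlonglongrightarrow> ln 2 / b"
      using b by (real_asymp, simp add: field_simps)
    then have "\<forall>\<^sub>F d in sequentially. y < ln 2 / ((1 + 1 / real d) * b) \<and> 2 \<le> d"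
      using y by (intro eventually_conj order_tendstoD eventually_ge_at_top)
    then obtain d :: nat where d: "y < ln 2 / ((1 + 1 / real d) * b)" "2 \<le> d"
      by (auto simp: eventually_sequentially)
    define c where "c = (1 + 1 / real d) * b"
    have c: "0 < c" using b by (auto simp: c_def intro!: mult_pos_pos add_pos_nonneg)
    \<comment> \<open>The finest level whose crossings are all guaranteed to last at least \<open>e\<close>.\<close>
    let ?n = "\<lambda>e::real. nat \<lfloor>- ln e / c\<rfloor>"
    have n_lim: "filterlim ?n sequentially (at_right 0)"
      using c by real_asymp
    have lim: "((\<lambda>e::real. ((- ln e / c - 1) * ln 2 - ln 3) / (- ln e)) \<longlongrightarrow> ln 2 / c) (at_right 0)"
      using c by (real_asymp, simp add: field_simps)
    have lim_gt: "\<forall>\<^sub>F e in at_right 0. y < ((- ln e / c - 1) * ln 2 - ln 3) / (- ln e)"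
      by (rule order_tendstoD(1)[OF lim]) (use d in \<open>simp add: c_def\<close>)
    have small: "\<forall>\<^sub>F e::real in at_right 0. e < 1"
      by (rule eventually_at_rightI[of 0 1]) auto
    have "\<forall>\<^sub>F e in at_right 0. ereal y < ?f e"
      using filterlim_iff[THEN iffD1, OF n_lim, rule_format, OF regular[OF d(2)]]
        filterlim_iff[THEN iffD1, OF n_lim, rule_format, OF reach[OF d(2)]]
        lim_gt small eventually_at_right_less[of 0]
    proof eventually_elim
      case (elim e)
      let ?l = "\<mu> powr (- (1 + 1 / real d) * real (?n e))"
      have ln_e: "ln e < 0" using elim by simp
      have n_le: "real (?n e) \<le> - ln e / c"
        using ln_e c by (simp add: divide_nonpos_pos)
      have "real (?n e) * c \<le> - ln e"
        using n_le c by (simp only: pos_le_divide_eq)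
      then have "exp (ln e) \<le> exp (- real (?n e) * c)"
        unfolding exp_le_cancel_iff by linarith
      then have "e \<le> exp (- real (?n e) * c)" using elim by simp
      also have "\<dots> = ?l" by (simp add: powr_b c_def algebra_simps)
      finally have e_le: "e \<le> ?l" .
      have osc: "\<bar>x u - x t\<bar> \<le> 3 * 2 powi (- int (?n e))" if "0 \<le> u" "\<bar>u - t\<bar> < e" for u
      proof (cases "t \<le> u")
        case True
        then show ?thesis
          using elim t that e_le
          by (intro oscillation_le[OF cont start hits, of "?K (?n e)" ?l _ 2]) auto
      next
        case False
        have "\<bar>x t - x u\<bar> \<le> 3 * 2 powi (- int (?n e))"
          using elim t that e_le False
          by (intro oscillation_le[OF cont start hits, of "?K (?n e)" ?l _ 2]) auto
        then show ?thesis by linarith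
      qed
      have "- ln e / c - 1 \<le> real (?n e)" by linarith
      then have "(- ln e / c - 1) * ln 2 - ln 3 \<le> real (?n e) * ln 2 - ln 3"
        by (intro diff_right_mono mult_right_mono) auto
      then have "((- ln e / c - 1) * ln 2 - ln 3) / (- ln e) \<le> (real (?n e) * ln 2 - ln 3) / (- ln e)"
        using ln_e by (intro divide_right_mono) auto
      also have "\<dots> = ln (3 * 2 powi (- int (?n e))) / ln e"
        by (simp only: ln_lattice minus_divide_right[symmetric] minus_divide_left minus_diff_eq)
      finally have "y < ln (3 * 2 powi (- int (?n e))) / ln e" using elim by linarith
      then have "ereal y < ereal (ln (3 * 2 powi (- int (?n e))) / ln e)" by simp
      also have "\<dots> \<le> ?f e" using elim osc by (intro log_oscillation_ge) auto
      finally show ?case .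
    qed
    then show ?thesis
      by (intro Liminf_bounded) (auto elim: eventually_mono)
  qed
  have lower: "ereal (ln 2 / b) \<le> Liminf (at_right 0) ?f"
  proof (rule dense_le)
    fix z assume "z < ereal (ln 2 / b)"
    then obtain y where zy: "z < ereal y" and yb: "ereal y < ereal (ln 2 / b)"
      using ereal_dense2 by blast
    from yb have "ereal y \<le> Liminf (at_right 0) ?f" by (intro lower_y) simp
    with zy show "z \<le> Liminf (at_right 0) ?f" by (rule order_trans[OF less_imp_le])
  qed
  have upper_y: "Liminf (at_right 0) ?f \<le> ereal y" if y: "ln 2 / b < y" for y
  proof (rule ccontr)
    assume "\<not> ?thesis"
    then have large: "\<forall>\<^sub>F e in at_right 0. ereal y < ?f e"
      by (intro less_LiminfD) (simp only: not_le)
    have "(\<lambda>d::nat. ln 2 / ((1 - 1 / real d) * b)) \<longlonglongrightarrow> ln 2 / b"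
      using b by (real_asymp, simp add: field_simps)
    then have "\<forall>\<^sub>F d in sequentially. ln 2 / ((1 - 1 / real d) * b) < y \<and> 2 \<le> d"
      using y by (intro eventually_conj order_tendstoD eventually_ge_at_top)
    then obtain d :: nat where d: "ln 2 / ((1 - 1 / real d) * b) < y" "2 \<le> d"
      by (auto simp: eventually_sequentially)
    define c where "c = (1 - 1 / real d) * b"
    have c: "0 < c" using b d by (auto simp: c_def intro!: mult_pos_pos)
    \<comment> \<open>The factor 2 makes the strict inequality \<open>\<bar>u - t\<bar> < ?e n\<close> hold at both ends of a crossing.\<close>
    let ?e = "\<lambda>n::nat. 2 * exp (- c * real n)"
    have e_lim: "filterlim ?e (at_right 0) sequentially"
      using c by real_asymp
    have "(\<lambda>n::nat. (- (real n + 1) * ln 2) / (ln 2 - c * real n)) \<longlonglongrightarrow> ln 2 / c"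
      using c by (real_asymp, simp add: field_simps)
    then have lim: "\<forall>\<^sub>F n in sequentially. (- (real n + 1) * ln 2) / (ln 2 - c * real n) < y"
      by (rule order_tendstoD) (use d in \<open>simp add: c_def\<close>)
    have small: "\<forall>\<^sub>F n in sequentially. ?e n < 1"
      using c by real_asymp
    have "\<forall>\<^sub>F n::nat in sequentially. False"
      using filterlim_iff[THEN iffD1, OF e_lim, rule_format, OF large]
        regular[OF d(2)] reach[OF d(2)] lim small
    proof eventually_elim
      case (elim n)
      have "real (?K n) * \<mu> powr (- (1 + 1 / real d) * real n) \<le> passage x (- int n) (?K n)"
        using elim by (intro passage_ge[OF cont start hits]) auto
      then have "t \<le> passage x (- int n) (?K n)" using elim t by auto
      moreover have "0 < ?K n" using \<mu> by simp
      moreover have "\<mu> powr (- (1 - 1 / real d) * real n) = exp (- c * real n)"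
        by (simp add: powr_b c_def algebra_simps)
      ultimately have "\<exists>u\<ge>0. \<bar>u - t\<bar> \<le> exp (- c * real n) \<and> 2 powi (- int n) / 2 \<le> \<bar>x u - x t\<bar>"
        using elim t by (intro oscillation_ge[OF cont start hits, of "?K n"]) auto
      then obtain u where u: "0 \<le> u" "\<bar>u - t\<bar> \<le> exp (- c * real n)"
          "2 powi (- int n) / 2 \<le> \<bar>x u - x t\<bar>"
        by blast
      have "ereal y < ?f (?e n)" using elim by simp
      also have "?f (?e n) \<le> ereal (ln (2 powi (- int n) / 2) / ln (?e n))"
        using elim u(1,3) le_less_trans[OF u(2), of "?e n"]
        by (intro log_oscillation_le[of _ _ u]) simp_all
      also have "ln (2 powi (- int n) / 2) / ln (?e n) = (- (real n + 1) * ln 2) / (ln 2 - c * real n)"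
        by (simp add: ln_mult ln_div two_powi algebra_simps)
      finally show ?case using elim by simp
    qed
    then show False by simp
  qed
  have "Liminf (at_right 0) ?f \<le> ereal (ln 2 / b)"
  proof (rule dense_ge)
    fix z assume "ereal (ln 2 / b) < z"
    then obtain y where yb: "ereal (ln 2 / b) < ereal y" and yz: "ereal y < z"
      using ereal_dense2 by blast
    from yb have "Liminf (at_right 0) ?f \<le> ereal y" by (intro upper_y) simp
    then show "Liminf (at_right 0) ?f \<le> z" using less_imp_le[OF yz] by (rule order_trans)
  qed
  with lower show ?thesis
    by (simp add: local_holder_exponent_def b_def)
qed

section \<open>Generating functions of Galton-Watson processes\<close>

text \<open>Values in \<open>ennreal\<close> allow arguments above 1, where the integral
may be infinite: arguments below 1 give Laplace transforms, those above 1 exponential moments.\<close>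

definition generating_function :: "nat pmf \<Rightarrow> ennreal \<Rightarrow> ennreal" where
  "generating_function Z c = (\<integral>\<^sup>+k. c ^ k \<partial>measure_pmf Z)"

lemma ennreal_power_mono: "a \<le> b \<Longrightarrow> a ^ k \<le> b ^ k" for a b :: ennreal
  by (induction k) (auto intro: mult_mono)

lemma generating_function_mono: "a \<le> b \<Longrightarrow> generating_function Z a \<le> generating_function Z b"
  unfolding generating_function_def by (intro nn_integral_mono ennreal_power_mono)

text \<open>For \<open>c \<le> 1\<close> the powers of \<open>c\<close> decrease, so the smallest offspring number dominates.\<close>

lemma generating_function_le_square:
  assumes "set_pmf Z \<subseteq> {k. 2 \<le> k}" "c \<le> 1"
  shows "generating_function Z c \<le> c\<^sup>2"
proof -
  have "c ^ k \<le> c\<^sup>2" if "2 \<le> k" for k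
  proof -
    have "c ^ k = c\<^sup>2 * c ^ (k - 2)"
      using that by (metis le_add_diff_inverse power_add)
    also have "\<dots> \<le> c\<^sup>2 * 1 ^ (k - 2)" by (intro mult_left_mono ennreal_power_mono assms) auto
    finally show ?thesis by simp
  qed
  then have "generating_function Z c \<le> (\<integral>\<^sup>+k. c\<^sup>2 \<partial>measure_pmf Z)"
    unfolding generating_function_def using assms
    by (intro nn_integral_mono_AE) (auto simp: AE_measure_pmf_iff)
  then show ?thesis by simp
qed

lemma prob_space_gw_space: "prob_space (gw_space Z)"
  unfolding gw_space_def by (intro prob_space_PiM measure_pmf.prob_space_axioms)

lemma space_gw_space [simp]: "space (gw_space Z) = UNIV"
  by (auto simp: gw_space_def space_PiM)

lemma measurable_gw_size:
  assumes "{..<m} \<times> UNIV \<subseteq> I"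
  shows "(\<lambda>\<xi>. gw_size \<xi> m) \<in> measurable (\<Pi>\<^sub>M p\<in>I. measure_pmf Z) (count_space UNIV)"
  using assms
proof (induction m)
  case (Suc m)
  have [measurable]: "(\<lambda>\<xi>. gw_size \<xi> m) \<in> measurable (\<Pi>\<^sub>M p\<in>I. measure_pmf Z) (count_space UNIV)"
    using Suc by (auto simp: subset_iff)
  have "(\<lambda>\<xi>. \<Sum>i<N. \<xi> (m, i)) \<in> measurable (\<Pi>\<^sub>M p\<in>I. measure_pmf Z) (count_space UNIV)" for N
  proof -
    have "(\<lambda>\<xi>. \<xi> (m, i)) \<in> measurable (\<Pi>\<^sub>M p\<in>I. measure_pmf Z) (count_space UNIV)" for i
      using Suc.prems by (intro measurable_compose[OF measurable_component_singleton]) auto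
    then have "(\<lambda>\<xi>. \<Sum>i<N. \<xi> (m, i)) \<in> borel_measurable (\<Pi>\<^sub>M p\<in>I. measure_pmf Z)"
      by (intro borel_measurable_sum)
         (simp_all add: measurable_cong_sets[OF refl sets_borel_eq_count_space])
    then show ?thesis by (simp add: measurable_cong_sets[OF refl sets_borel_eq_count_space])
  qed
  then show ?case
    using measurable_compose_countable[where f="\<lambda>N \<xi>. \<Sum>i<N. \<xi> (m, i)" and g="\<lambda>\<xi>. gw_size \<xi> m"]
    by simp
qed simp

lemma measurable_gw_size_gw_space [measurable]: "(\<lambda>\<xi>. gw_size \<xi> m) \<in> measurable (gw_space Z) (count_space UNIV)"
  unfolding gw_space_def by (intro measurable_gw_size) simp

text \<open>The size of generation \<open>m\<close> depends on earlier generations only; hence it is independent of the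
offspring numbers of generation \<open>m\<close>.\<close>

lemma gw_size_restrict: "gw_size (restrict \<xi> ({..<m} \<times> UNIV)) m = gw_size \<xi> m"
proof -
  have "gw_size (restrict \<xi> ({..<m} \<times> UNIV)) j = gw_size \<xi> j" if "j \<le> m" for j
    using that by (induction j) auto
  then show ?thesis by simp
qed

lemma indep_vars_gw_space:
  "prob_space.indep_vars (gw_space Z) (\<lambda>_. measure_pmf Z) (\<lambda>p \<xi>. \<xi> p) UNIV"
proof -
  interpret prob_space "gw_space Z" by (rule prob_space_gw_space)
  interpret P: product_prob_space "\<lambda>_::nat \<times> nat. measure_pmf Z" UNIV ..
  have rv: "random_variable (measure_pmf Z) (\<lambda>\<xi>. \<xi> p)" for p
    unfolding gw_space_def by measurable
  have "distr (gw_space Z) (measure_pmf Z) (\<lambda>\<xi>. \<xi> p) = measure_pmf Z" for p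
    unfolding gw_space_def by (rule P.PiM_component) simp
  moreover have "distr (gw_space Z) (\<Pi>\<^sub>M p\<in>UNIV. measure_pmf Z) (\<lambda>\<xi>. \<lambda>p\<in>UNIV. \<xi> p) = gw_space Z"
    by (simp add: gw_space_def restrict_UNIV)
  ultimately show ?thesis
    by (subst indep_vars_iff_distr_eq_PiM[OF _ rv]) (auto simp: gw_space_def)
qed

text \<open>Split according to the size \<open>n\<close> of generation \<open>m\<close>. On each part the power is a product of
\<open>n\<close> independent factors, one for each individual, times an indicator of the past, so that the
integral factorizes.\<close>

lemma nn_integral_power_gw_size_Suc:
  "(\<integral>\<^sup>+\<xi>. c ^ gw_size \<xi> (Suc m) \<partial>gw_space Z) = (\<integral>\<^sup>+\<xi>. generating_function Z c ^ gw_size \<xi> m \<partial>gw_space Z)"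
proof -
  interpret prob_space "gw_space Z" by (rule prob_space_gw_space)
  interpret P: product_prob_space "\<lambda>_::nat \<times> nat. measure_pmf Z" UNIV ..
  let ?past = "{..<m} \<times> UNIV :: (nat \<times> nat) set"
  let ?ind = "\<lambda>n \<xi>. indicator {n} (gw_size \<xi> m) :: ennreal"
  have rv [measurable]: "(\<lambda>\<xi>. \<xi> p) \<in> measurable (gw_space Z) (count_space UNIV)" for p
    unfolding gw_space_def by (rule measurable_compose[OF measurable_component_singleton]) auto
  have split_size: "f = (\<Sum>n. ?ind n \<xi> * f)" for f \<xi>
  proof -
    have "(\<lambda>n. if n = gw_size \<xi> m then f else 0) sums f" by (rule sums_single)
    moreover have "(\<lambda>n. if n = gw_size \<xi> m then f else 0) = (\<lambda>n. ?ind n \<xi> * f)"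
      by (auto simp: fun_eq_iff)
    ultimately show ?thesis by (simp add: sums_iff)
  qed
  have [measurable]: "?ind n \<in> borel_measurable (gw_space Z)" for n
    by (rule measurable_compose[OF measurable_gw_size_gw_space]) simp
  have split: "(\<integral>\<^sup>+\<xi>. ?ind n \<xi> * (\<Prod>i<n. c ^ \<xi> (m, i)) \<partial>gw_space Z)
      = (\<integral>\<^sup>+\<xi>. ?ind n \<xi> * generating_function Z c ^ n \<partial>gw_space Z)" for n
  proof -
    \<comment> \<open>Index 0 stands for the past, index \<open>Suc i\<close> for the individual \<open>i\<close> of generation \<open>m\<close>.\<close>
    let ?K = "\<lambda>j. case j of 0 \<Rightarrow> ?past | Suc i \<Rightarrow> {(m, i)}"
    let ?Y = "\<lambda>j \<eta>. case j of 0 \<Rightarrow> ?ind n \<eta> | Suc i \<Rightarrow> c ^ \<eta> (m, i)"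
    have "indep_vars (\<lambda>j. \<Pi>\<^sub>M p\<in>?K j. measure_pmf Z) (\<lambda>j \<xi>. restrict \<xi> (?K j)) {..n}"
      by (rule indep_vars_restrict[OF indep_vars_gw_space])
         (auto simp: disjoint_family_on_def split: nat.splits)
    then have "indep_vars (\<lambda>_. borel) (\<lambda>j \<xi>. ?Y j (restrict \<xi> (?K j))) {..n}"
    proof (rule indep_vars_compose2)
      fix j assume "j \<in> {..n}"
      show "?Y j \<in> measurable (\<Pi>\<^sub>M p\<in>?K j. measure_pmf Z) borel"
      proof (cases j)
        case 0
        have "(\<lambda>\<eta>. gw_size \<eta> m) \<in> measurable (\<Pi>\<^sub>M p\<in>?past. measure_pmf Z) (count_space UNIV)"
          by (rule measurable_gw_size) simp
        then have "?ind n \<in> measurable (\<Pi>\<^sub>M p\<in>?past. measure_pmf Z) borel"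
          by (rule measurable_compose) simp
        then show ?thesis using 0 by simp
      next
        case (Suc i)
        have "(\<lambda>\<eta>. \<eta> (m, i)) \<in> measurable (\<Pi>\<^sub>M p\<in>{(m, i)}. measure_pmf Z) (count_space UNIV)"
          by (rule measurable_compose[OF measurable_component_singleton]) auto
        then have "(\<lambda>\<eta>. c ^ \<eta> (m, i)) \<in> measurable (\<Pi>\<^sub>M p\<in>{(m, i)}. measure_pmf Z) borel"
          by (rule measurable_compose) simp
        then show ?thesis using Suc by simp
      qed
    qed
    moreover have "?Y j (restrict \<xi> (?K j)) = ?Y j \<xi>" for j \<xi>
      by (simp add: gw_size_restrict split: nat.splits)
    ultimately have "indep_vars (\<lambda>_. borel) ?Y {..n}" by simp
    then have "(\<integral>\<^sup>+\<xi>. (\<Prod>j\<le>n. ?Y j \<xi>) \<partial>gw_space Z) = (\<Prod>j\<le>n. \<integral>\<^sup>+\<xi>. ?Y j \<xi> \<partial>gw_space Z)"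
      by (intro indep_vars_nn_integral) auto
    moreover have "(\<integral>\<^sup>+\<xi>. c ^ \<xi> (m, i) \<partial>gw_space Z) = generating_function Z c" for i
    proof -
      have "(\<integral>\<^sup>+\<xi>. c ^ \<xi> (m, i) \<partial>gw_space Z)
          = (\<integral>\<^sup>+k. c ^ k \<partial>distr (gw_space Z) (measure_pmf Z) (\<lambda>\<xi>. \<xi> (m, i)))"
        using rv by (subst nn_integral_distr) simp_all
      also have "distr (gw_space Z) (measure_pmf Z) (\<lambda>\<xi>. \<xi> (m, i)) = measure_pmf Z"
        unfolding gw_space_def by (rule P.PiM_component) simp
      finally show ?thesis by (simp add: generating_function_def)
    qed
    ultimately have "(\<integral>\<^sup>+\<xi>. ?ind n \<xi> * (\<Prod>i<n. c ^ \<xi> (m, i)) \<partial>gw_space Z)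
        = (\<integral>\<^sup>+\<xi>. ?ind n \<xi> \<partial>gw_space Z) * generating_function Z c ^ n"
      by (simp add: prod.atMost_shift)
    also have "\<dots> = (\<integral>\<^sup>+\<xi>. ?ind n \<xi> * generating_function Z c ^ n \<partial>gw_space Z)"
      by (rule nn_integral_multc[symmetric]) measurable
    finally show ?thesis .
  qed
  have "(\<integral>\<^sup>+\<xi>. c ^ gw_size \<xi> (Suc m) \<partial>gw_space Z)
      = (\<integral>\<^sup>+\<xi>. (\<Sum>n. ?ind n \<xi> * (\<Prod>i<n. c ^ \<xi> (m, i))) \<partial>gw_space Z)"
  proof (intro nn_integral_cong)
    fix \<xi> :: "nat \<times> nat \<Rightarrow> nat"
    have "c ^ gw_size \<xi> (Suc m) = (\<Sum>n. ?ind n \<xi> * (\<Prod>i<gw_size \<xi> m. c ^ \<xi> (m, i)))"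
      by (subst split_size[symmetric]) (simp add: power_sum)
    also have "\<dots> = (\<Sum>n. ?ind n \<xi> * (\<Prod>i<n. c ^ \<xi> (m, i)))"
      by (intro suminf_cong) (simp split: split_indicator)
    finally show "c ^ gw_size \<xi> (Suc m) = \<dots>" .
  qed
  also have "\<dots> = (\<Sum>n. \<integral>\<^sup>+\<xi>. ?ind n \<xi> * (\<Prod>i<n. c ^ \<xi> (m, i)) \<partial>gw_space Z)"
    by (rule nn_integral_suminf) measurable
  also have "\<dots> = (\<Sum>n. \<integral>\<^sup>+\<xi>. ?ind n \<xi> * generating_function Z c ^ n \<partial>gw_space Z)"
    by (simp only: split)
  also have "\<dots> = (\<integral>\<^sup>+\<xi>. (\<Sum>n. ?ind n \<xi> * generating_function Z c ^ n) \<partial>gw_space Z)"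
    by (rule nn_integral_suminf[symmetric]) measurable
  also have "\<dots> = (\<integral>\<^sup>+\<xi>. generating_function Z c ^ gw_size \<xi> m \<partial>gw_space Z)"
  proof (intro nn_integral_cong)
    fix \<xi> :: "nat \<times> nat \<Rightarrow> nat"
    have "(\<Sum>n. ?ind n \<xi> * generating_function Z c ^ n) = (\<Sum>n. ?ind n \<xi> * generating_function Z c ^ gw_size \<xi> m)"
      by (intro suminf_cong) (simp split: split_indicator)
    then show "(\<Sum>n. ?ind n \<xi> * generating_function Z c ^ n) = generating_function Z c ^ gw_size \<xi> m"
      using split_size by simp
  qed
  finally show ?thesis .
qed

lemma nn_integral_power_gw_size:
  "(\<integral>\<^sup>+\<xi>. c ^ gw_size \<xi> m \<partial>gw_space Z) = (generating_function Z ^^ m) c"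
proof (induction m arbitrary: c)
  case 0
  interpret prob_space "gw_space Z" by (rule prob_space_gw_space)
  show ?case by (simp add: emeasure_space_1 del: space_gw_space)
next
  case (Suc m)
  then show ?case
    by (simp only: nn_integral_power_gw_size_Suc funpow_Suc_right o_apply)
qed

section \<open>Left tail of the Galton-Watson limit\<close>

text \<open>Chernoff's bound: \<open>exp (1 - V / v)\<close> is at least 1 where \<open>V \<le> v\<close>.\<close>

lemma (in prob_space) prob_le_laplace:
  assumes [measurable]: "V \<in> borel_measurable M" and "AE \<omega> in M. 0 < V \<omega>" and "0 < v"
  shows "\<P>(\<omega> in M. V \<omega> \<le> v) \<le> exp 1 * expectation (\<lambda>\<omega>. exp (- (1 / v) * V \<omega>))"
proof -
  have int: "integrable M (\<lambda>\<omega>. exp (- (1 / v) * V \<omega>))"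
    using assms(2,3) by (intro integrable_const_bound[where B=1]) (auto elim!: eventually_mono)
  have "\<P>(\<omega> in M. V \<omega> \<le> v) = expectation (indicator {\<omega>\<in>space M. V \<omega> \<le> v})"
    by simp
  also have "\<dots> \<le> expectation (\<lambda>\<omega>. exp 1 * exp (- (1 / v) * V \<omega>))"
  proof (intro integral_mono)
    fix \<omega> assume "\<omega> \<in> space M"
    show "indicator {\<omega>\<in>space M. V \<omega> \<le> v} \<omega> \<le> exp 1 * exp (- (1 / v) * V \<omega>)"
      using \<open>0 < v\<close> by (auto simp: indicator_def field_simps simp flip: exp_add)
  next
    show "integrable M (indicat_real {\<omega>\<in>space M. V \<omega> \<le> v})"
      by (intro integrable_real_indicator) (auto simp: emeasure_eq_measure)
  qed (use int in auto)
  finally show ?thesis by simp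
qed

text \<open>The Laplace transform \<open>\<phi>\<close> tends to 0 because \<open>V > 0\<close>. Choose \<open>a\<close> with
\<open>\<phi> a \<le> 1 / \<mu> ^ q\<close>. For \<open>k \<ge> a\<close> one of the two factors in \<open>\<phi> (\<mu> * k) \<le> \<phi> k * \<phi> k\<close> is then at
most \<open>1 / \<mu> ^ q\<close>, so that \<open>\<phi>\<close> loses this factor whenever its argument grows by the factor
\<open>\<mu>\<close>. This is decay of order \<open>q\<close>, and the order is arbitrary.\<close>

lemma (in prob_space) left_tail_of_laplace_square:
  fixes \<mu> :: real and q :: nat
  assumes [measurable]: "V \<in> borel_measurable M" and pos: "AE \<omega> in M. 0 < V \<omega>" and \<mu>: "1 < \<mu>"
    and square: "\<And>l. 0 < l \<Longrightarrow>
      expectation (\<lambda>\<omega>. exp (- (\<mu> * l) * V \<omega>)) \<le> (expectation (\<lambda>\<omega>. exp (- l * V \<omega>)))\<^sup>2"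
  shows "\<exists>C\<ge>0. \<forall>v>0. \<P>(\<omega> in M. V \<omega> \<le> v) \<le> C * v ^ q"
proof -
  define \<phi> where "\<phi> l = expectation (\<lambda>\<omega>. exp (- l * V \<omega>))" for l
  have \<phi>_int: "integrable M (\<lambda>\<omega>. exp (- l * V \<omega>))" if "0 \<le> l" for l
    using pos that by (intro integrable_const_bound[where B=1]) (auto elim!: eventually_mono)
  have \<phi>_nonneg: "0 \<le> \<phi> l" for l
    unfolding \<phi>_def by (intro integral_nonneg_AE) auto
  have \<phi>_antimono: "\<phi> b \<le> \<phi> a" if "0 \<le> a" "a \<le> b" for a b
    unfolding \<phi>_def using pos that
    by (intro integral_mono_AE \<phi>_int) (auto elim!: eventually_mono)
  have \<phi>_le_1: "\<phi> l \<le> 1" if "0 \<le> l" for l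
    using \<phi>_antimono[of 0 l] that by (simp add: \<phi>_def prob_space)
  have "(\<lambda>i::nat. \<phi> (real i)) \<longlonglongrightarrow> expectation (\<lambda>\<omega>. 0)"
    unfolding \<phi>_def
  proof (rule integral_dominated_convergence[where w="\<lambda>_. 1"])
    show "AE \<omega> in M. (\<lambda>i::nat. exp (- real i * V \<omega>)) \<longlonglongrightarrow> 0"
      using pos by eventually_elim real_asymp
    show "AE \<omega> in M. norm (exp (- real i * V \<omega>)) \<le> 1" for i
      using pos by eventually_elim auto
  qed auto
  then have "(\<lambda>i::nat. \<phi> (real i)) \<longlonglongrightarrow> 0" by simp
  then have "\<forall>\<^sub>F i in sequentially. \<phi> (real i) < 1 / \<mu> ^ q \<and> 1 \<le> i"
    using \<mu> by (intro eventually_conj order_tendstoD eventually_ge_at_top) auto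
  then obtain i :: nat where "\<phi> (real i) < 1 / \<mu> ^ q" "1 \<le> i"
    by (auto simp: eventually_sequentially)
  then obtain a where a: "0 < a" "\<phi> a \<le> 1 / \<mu> ^ q"
    by (intro that[of "real i"]) auto
  have bound: "\<phi> l \<le> (\<mu> * a / l) ^ q" if "0 < l" "l \<le> a * \<mu> ^ j" for l and j :: nat
    using that
  proof (induction j arbitrary: l)
    case 0
    then have "1 \<le> \<mu> * a / l" using \<mu> a by (simp add: field_simps) (smt (verit) mult_less_cancel_right1)
    then show ?case using \<phi>_le_1[of l] 0 one_le_power[of "\<mu> * a / l" q] by linarith
  next
    case (Suc j)
    show ?case
    proof (cases "l \<le> \<mu> * a")
      case True
      then have "1 \<le> \<mu> * a / l" using Suc by simp
      then show ?thesis using \<phi>_le_1[of l] Suc one_le_power[of "\<mu> * a / l" q] by linarith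
    next
      case False
      define k where "k = l / \<mu>"
      have k: "l = \<mu> * k" "a \<le> k" "0 < k" "k \<le> a * \<mu> ^ j"
        using \<mu> a False Suc.prems by (auto simp: k_def field_simps)
      have "\<phi> l \<le> \<phi> k * \<phi> k"
        using square[of k] k by (simp add: \<phi>_def power2_eq_square)
      also have "\<dots> \<le> (1 / \<mu> ^ q) * (\<mu> * a / k) ^ q"
        using a k \<phi>_antimono[of a k] Suc.IH[of k] \<phi>_nonneg \<mu>
        by (intro mult_mono) auto
      also have "\<dots> = (\<mu> * a / l) ^ q"
        using \<mu> by (simp add: k(1) power_divide power_mult_distrib field_simps)
      finally show ?thesis .
    qed
  qed
  have "\<P>(\<omega> in M. V \<omega> \<le> v) \<le> exp 1 * (\<mu> * a) ^ q * v ^ q" if "0 < v" for v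
  proof -
    obtain j where "1 / v / a < \<mu> ^ j" using real_arch_pow[OF \<mu>] by blast
    then have "\<phi> (1 / v) \<le> (\<mu> * a / (1 / v)) ^ q"
      using a that by (intro bound[of _ j]) (auto simp: field_simps)
    moreover have "\<P>(\<omega> in M. V \<omega> \<le> v) \<le> exp 1 * \<phi> (1 / v)"
      unfolding \<phi>_def using pos that by (intro prob_le_laplace) auto
    ultimately have "\<P>(\<omega> in M. V \<omega> \<le> v) \<le> exp 1 * (\<mu> * a / (1 / v)) ^ q"
      by (meson exp_ge_zero mult_left_mono order_trans)
    then show ?thesis by (simp add: power_mult_distrib algebra_simps)
  qed
  then show ?thesis using \<mu> a by (intro exI[of _ "exp 1 * (\<mu> * a) ^ q"]) auto
qed

lemma tendsto_exp_gw_size: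
  assumes "gw_limit Z W"
  shows "AE \<xi> in gw_space Z.
    (\<lambda>m. ennreal (exp (l / pmf_mean Z ^ m)) ^ gw_size \<xi> m) \<longlonglongrightarrow> ennreal (exp (l * W \<xi>))"
proof -
  have "AE \<xi> in gw_space Z. (\<lambda>m. real (gw_size \<xi> m) / pmf_mean Z ^ m) \<longlonglongrightarrow> W \<xi>"
    using assms by (simp add: gw_limit_def)
  then show ?thesis
  proof eventually_elim
    case (elim \<xi>)
    then have "(\<lambda>m. exp (l * (real (gw_size \<xi> m) / pmf_mean Z ^ m))) \<longlonglongrightarrow> exp (l * W \<xi>)"
      by (intro tendsto_intros)
    moreover have "exp (l * (real (gw_size \<xi> m) / pmf_mean Z ^ m))
        = exp (l / pmf_mean Z ^ m) ^ gw_size \<xi> m" for m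
      by (simp flip: exp_of_nat_mult add: field_simps)
    ultimately show ?case
      by (simp add: ennreal_power)
  qed
qed

text \<open>The inequality \<open>generating_function Z c \<le> c\<^sup>2\<close>, applied to the outermost of \<open>m + 1\<close> iterates of the
generating function at \<open>exp (- l / pmf_mean Z ^ m)\<close>, passes to the limit in \<open>m\<close>. The normalization
by the mean turns the argument \<open>l\<close> at generation \<open>m\<close> into \<open>pmf_mean Z * l\<close> at generation
\<open>m + 1\<close>.\<close>

lemma gw_limit_laplace_square:
  assumes W: "gw_limit Z W" and Z: "set_pmf Z \<subseteq> {k. 2 \<le> k}" and \<mu>: "0 < pmf_mean Z" and l: "0 \<le> l"
  shows "(\<integral>\<^sup>+\<xi>. ennreal (exp (- (pmf_mean Z * l) * W \<xi>)) \<partial>gw_space Z)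
    \<le> (\<integral>\<^sup>+\<xi>. ennreal (exp (- l * W \<xi>)) \<partial>gw_space Z)\<^sup>2"
proof -
  interpret prob_space "gw_space Z" by (rule prob_space_gw_space)
  have [measurable]: "W \<in> borel_measurable (gw_space Z)" using W by (simp add: gw_limit_def)
  define c where "c l m = ennreal (exp (- l / pmf_mean Z ^ m))" for l and m :: nat
  have c_le: "c l m \<le> 1" if "0 \<le> l" for l m
    using that \<mu> by (simp add: c_def)
  have power_le: "a ^ k \<le> 1" if "a \<le> 1" for a :: ennreal and k
    using ennreal_power_mono[OF that, of k] by simp
  have [measurable]: "(\<lambda>\<xi>. a ^ gw_size \<xi> m) \<in> borel_measurable (gw_space Z)" for a :: ennreal and m
    by (rule measurable_compose[OF measurable_gw_size_gw_space]) simp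
  have lim: "(\<lambda>m. (generating_function Z ^^ m) (c l m)) \<longlonglongrightarrow> (\<integral>\<^sup>+\<xi>. ennreal (exp (- l * W \<xi>)) \<partial>gw_space Z)"
    if "0 \<le> l" for l
    unfolding nn_integral_power_gw_size[symmetric]
  proof (rule nn_integral_dominated_convergence[where w="\<lambda>_. 1"])
    show "AE \<xi> in gw_space Z. (\<lambda>m. c l m ^ gw_size \<xi> m) \<longlonglongrightarrow> ennreal (exp (- l * W \<xi>))"
      using tendsto_exp_gw_size[OF W, of "- l"] by (simp add: c_def)
    show "AE \<xi> in gw_space Z. c l m ^ gw_size \<xi> m \<le> 1" for m
      using power_le[OF c_le[OF that]] by auto
  qed (auto simp: emeasure_space_1[simplified])
  have le_1: "(generating_function Z ^^ m) (c l m) \<le> 1" for m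
  proof -
    have "(generating_function Z ^^ m) (c l m) \<le> (\<integral>\<^sup>+\<xi>. 1 \<partial>gw_space Z)"
      unfolding nn_integral_power_gw_size[symmetric]
      by (intro nn_integral_mono power_le c_le l)
    then show ?thesis by (simp add: emeasure_space_1[simplified])
  qed
  have "(\<lambda>m. ((generating_function Z ^^ m) (c l m))\<^sup>2) \<longlonglongrightarrow> (\<integral>\<^sup>+\<xi>. ennreal (exp (- l * W \<xi>)) \<partial>gw_space Z)\<^sup>2"
  proof -
    have "(\<integral>\<^sup>+\<xi>. ennreal (exp (- l * W \<xi>)) \<partial>gw_space Z) \<le> 1"
      using le_1 by (intro LIMSEQ_le_const2[OF lim[OF l]]) auto
    then show ?thesis
      unfolding power2_eq_square using lim[OF l]
      by (intro tendsto_mult_ennreal) (auto simp: top_unique)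
  qed
  moreover have "(\<lambda>m. (generating_function Z ^^ Suc m) (c (pmf_mean Z * l) (Suc m))) \<longlonglongrightarrow>
      (\<integral>\<^sup>+\<xi>. ennreal (exp (- (pmf_mean Z * l) * W \<xi>)) \<partial>gw_space Z)"
    using lim[of "pmf_mean Z * l"] \<mu> l by (intro LIMSEQ_Suc) auto
  moreover have "(generating_function Z ^^ Suc m) (c (pmf_mean Z * l) (Suc m)) \<le> ((generating_function Z ^^ m) (c l m))\<^sup>2" for m
  proof -
    have "c (pmf_mean Z * l) (Suc m) = c l m" using \<mu> by (simp add: c_def)
    then show ?thesis using generating_function_le_square[OF Z le_1[of m]] by simp
  qed
  ultimately show ?thesis by (intro LIMSEQ_le) auto
qed

theorem gw_limit_left_tail:
  assumes W: "gw_limit Z W" and Z: "set_pmf Z \<subseteq> {k. 2 \<le> k}" and \<mu>: "1 < pmf_mean Z"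
    and pos: "AE \<xi> in gw_space Z. 0 < W \<xi>"
  shows "\<exists>C\<ge>0. \<forall>v>0. \<P>(\<xi> in gw_space Z. W \<xi> \<le> v) \<le> C * v ^ q"
proof -
  interpret prob_space "gw_space Z" by (rule prob_space_gw_space)
  have [measurable]: "W \<in> borel_measurable (gw_space Z)" using W by (simp add: gw_limit_def)
  have laplace: "(\<integral>\<^sup>+\<xi>. ennreal (exp (- l * W \<xi>)) \<partial>gw_space Z) = ennreal (expectation (\<lambda>\<xi>. exp (- l * W \<xi>)))"
    if "0 \<le> l" for l
  proof (intro nn_integral_eq_integral)
    show "integrable (gw_space Z) (\<lambda>\<xi>. exp (- l * W \<xi>))"
      using pos that by (intro integrable_const_bound[where B=1]) (auto elim!: eventually_mono)
  qed auto
  show ?thesis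
  proof (rule left_tail_of_laplace_square[OF _ pos \<mu>])
    fix l :: real assume l: "0 < l"
    then have l': "0 \<le> l" "0 \<le> pmf_mean Z * l" "0 < pmf_mean Z" using \<mu> by auto
    show "expectation (\<lambda>\<xi>. exp (- (pmf_mean Z * l) * W \<xi>)) \<le> (expectation (\<lambda>\<xi>. exp (- l * W \<xi>)))\<^sup>2"
      using gw_limit_laplace_square[OF W Z l'(3,1)]
      unfolding laplace[OF l'(1)] laplace[OF l'(2)]
      by (subst (asm) ennreal_power) (auto simp: ennreal_le_iff)
  qed measurable
qed

section \<open>Right tail of the Galton-Watson limit\<close>

lemma exp_le_quadratic:
  assumes "0 \<le> (y::real)"
  shows "exp y \<le> 1 + y + y\<^sup>2 * exp y"
proof (cases "y \<le> 1")
  case True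
  then have "exp y \<le> 1 + y + y\<^sup>2 * 1" using exp_bound[of y] assms by simp
  also have "\<dots> \<le> 1 + y + y\<^sup>2 * exp y" using assms by (intro add_mono mult_left_mono) auto
  finally show ?thesis .
next
  case False
  then have "1 \<le> y\<^sup>2" by simp
  from mult_right_mono[OF this exp_ge_zero[of y]] show ?thesis using assms by linarith
qed

text \<open>To first order the logarithm of the generating function at \<open>exp v\<close> is \<open>pmf_mean Z * v\<close>. The
quadratic error is absorbed in the denominator \<open>1 - C * v\<close>, since maps of the form
\<open>\<lambda>v. \<mu> * v / (1 - C * v)\<close> are closed under composition.\<close>

lemma generating_function_le_linear_fractional:
  assumes u: "0 < u" "integrable (measure_pmf Z) (\<lambda>k. exp (u * real k))"
    and mean: "integrable (measure_pmf Z) real" "0 < pmf_mean Z"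
  shows "\<exists>r>0. \<exists>C>0. \<forall>v. 0 \<le> v \<and> v \<le> r \<longrightarrow> C * v < 1 \<and>
    generating_function Z (ennreal (exp v)) \<le> ennreal (exp (pmf_mean Z * v / (1 - C * v)))"
proof -
  let ?\<mu> = "pmf_mean Z"
  define E where "E = measure_pmf.expectation Z (\<lambda>k. exp (u * real k))"
  define C where "C = (8 / u\<^sup>2 * E + 1) / ?\<mu>"
  have E: "0 \<le> E" unfolding E_def by (intro integral_nonneg_AE) auto
  then have C: "0 < C" using mean u unfolding C_def by (intro divide_pos_pos add_nonneg_pos) auto
  define r where "r = min (u / 2) (1 / (2 * C))"
  have r: "0 < r" using u C by (simp add: r_def)
  have "C * v < 1 \<and> generating_function Z (ennreal (exp v)) \<le> ennreal (exp (?\<mu> * v / (1 - C * v)))"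
    if v: "0 \<le> v" "v \<le> r" for v
  proof
    have "C * v \<le> C * (1 / (2 * C))" using v C by (intro mult_left_mono) (auto simp: r_def)
    then show Cv: "C * v < 1" using C by simp
    have pointwise: "exp v ^ k \<le> 1 + v * real k + v\<^sup>2 * (8 / u\<^sup>2 * exp (u * real k))" for k
    proof -
      have "0 \<le> u / 2 * real k" using u by simp
      with exp_lower_Taylor_quadratic[OF this]
      have "(u / 2 * real k)\<^sup>2 / 2 \<le> exp (u / 2 * real k)" by linarith
      then have square: "(real k)\<^sup>2 \<le> 8 / u\<^sup>2 * exp (u / 2 * real k)"
        using u by (simp add: field_simps power2_eq_square)
      have "exp v ^ k = exp (v * real k)" by (simp flip: exp_of_nat_mult add: mult.commute)
      also have "\<dots> \<le> 1 + v * real k + (v * real k)\<^sup>2 * exp (v * real k)"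
        using v by (intro exp_le_quadratic) auto
      also have "(v * real k)\<^sup>2 * exp (v * real k) \<le> (v * real k)\<^sup>2 * exp (u / 2 * real k)"
        using v mult_right_mono[of v "u / 2" "real k"] by (intro mult_left_mono) (auto simp: r_def)
      also have "\<dots> = v\<^sup>2 * (real k)\<^sup>2 * exp (u / 2 * real k)" by (simp add: power_mult_distrib)
      also have "\<dots> \<le> v\<^sup>2 * (8 / u\<^sup>2 * exp (u / 2 * real k)) * exp (u / 2 * real k)"
        by (intro mult_right_mono mult_left_mono square) auto
      also have "\<dots> = v\<^sup>2 * (8 / u\<^sup>2 * exp (u * real k))"
        by (simp add: mult.assoc flip: exp_add)
      finally show ?thesis by simp
    qed
    have "generating_function Z (ennreal (exp v)) = (\<integral>\<^sup>+k. ennreal (exp v ^ k) \<partial>measure_pmf Z)"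
      by (simp add: generating_function_def ennreal_power)
    also have "\<dots> \<le> (\<integral>\<^sup>+k. ennreal (1 + v * real k + v\<^sup>2 * (8 / u\<^sup>2 * exp (u * real k))) \<partial>measure_pmf Z)"
      by (intro nn_integral_mono ennreal_leI pointwise)
    also have "\<dots> = ennreal (measure_pmf.expectation Z
        (\<lambda>k. 1 + v * real k + v\<^sup>2 * (8 / u\<^sup>2 * exp (u * real k))))"
      using u mean v by (intro nn_integral_eq_integral) auto
    also have "measure_pmf.expectation Z (\<lambda>k. 1 + v * real k + v\<^sup>2 * (8 / u\<^sup>2 * exp (u * real k)))
        = 1 + v * ?\<mu> + v\<^sup>2 * (8 / u\<^sup>2 * E)"
      using u mean by (simp add: E_def pmf_mean_def)
    also have "\<dots> \<le> 1 + (?\<mu> * v + ?\<mu> * C * v\<^sup>2)"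
    proof -
      have "?\<mu> * C = 8 / u\<^sup>2 * E + 1" using mean by (simp add: C_def)
      then show ?thesis by (simp only:) (simp add: algebra_simps)
    qed
    also have "\<dots> \<le> exp (?\<mu> * v + ?\<mu> * C * v\<^sup>2)"
      by (rule exp_ge_add_one_self)
    also have "\<dots> \<le> exp (?\<mu> * v / (1 - C * v))"
    proof -
      have "(?\<mu> * v + ?\<mu> * C * v\<^sup>2) * (1 - C * v) = ?\<mu> * v * (1 - (C * v)\<^sup>2)"
        by (simp add: power2_eq_square algebra_simps)
      also have "\<dots> \<le> ?\<mu> * v * 1" using mean v by (intro mult_left_mono) auto
      finally show ?thesis using Cv by (simp add: pos_le_divide_eq)
    qed
    finally show "generating_function Z (ennreal (exp v)) \<le> ennreal (exp (?\<mu> * v / (1 - C * v)))"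
      by (simp add: ennreal_leI)
  qed
  then show ?thesis using r C by blast
qed

text \<open>Let \<open>g v = \<mu> * v / (1 - C * v)\<close> and \<open>h l = l / (1 - c * l)\<close>. For \<open>c = C / (\<mu> - 1)\<close> the map
\<open>h\<close> conjugates multiplication by \<open>\<mu>\<close> to \<open>g\<close>, that is \<open>g (h s) = h (\<mu> * s)\<close>. Hence \<open>m\<close>
iterations starting from \<open>h (l / \<mu> ^ m)\<close>, which is at least \<open>l / \<mu> ^ m\<close>, end at \<open>h l\<close>, a bound
that does not depend on \<open>m\<close>.\<close>

lemma gw_size_exponential_moment:
  fixes \<mu> :: real
  assumes \<mu>: "\<mu> = pmf_mean Z" "1 < \<mu>" and C: "0 < C"
    and step: "\<And>v. 0 \<le> v \<Longrightarrow> v \<le> r \<Longrightarrow> C * v < 1 \<and>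
      generating_function Z (ennreal (exp v)) \<le> ennreal (exp (\<mu> * v / (1 - C * v)))"
    and c: "c = C / (\<mu> - 1)"
    and l: "0 \<le> l" "c * l < 1" "l / (1 - c * l) \<le> r"
  shows "(generating_function Z ^^ m) (ennreal (exp (l / \<mu> ^ m))) \<le> ennreal (exp (l / (1 - c * l)))"
proof -
  have c0: "0 < c" using C \<mu> by (simp add: c)
  have "(generating_function Z ^^ m) (ennreal (exp ((l / \<mu> ^ m) / (1 - c * (l / \<mu> ^ m))))) \<le> ennreal (exp (l / (1 - c * l)))"
    using l
  proof (induction m arbitrary: l)
    case (Suc m)
    define s where "s = l / \<mu>"
    have s: "l = \<mu> * s" "0 \<le> s" "s \<le> l" using \<mu> Suc.prems mult_left_mono[of 1 \<mu> l] by (auto simp: s_def field_simps)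
    have cs: "c * s \<le> c * l" using s c0 by (intro mult_left_mono) auto
    then have cs1: "c * s < 1" using Suc.prems by linarith
    have h_le: "s / (1 - c * s) \<le> l / (1 - c * l)"
      using s cs Suc.prems by (intro frac_le) auto
    have r: "s / (1 - c * s) \<le> r" using h_le Suc.prems by linarith
    have "l / \<mu> ^ Suc m = s / \<mu> ^ m" by (simp add: s_def)
    then have "(generating_function Z ^^ Suc m) (ennreal (exp ((l / \<mu> ^ Suc m) / (1 - c * (l / \<mu> ^ Suc m)))))
        \<le> generating_function Z (ennreal (exp (s / (1 - c * s))))"
      using Suc.IH[OF s(2) cs1 r] by (simp add: generating_function_mono)
    also have "\<dots> \<le> ennreal (exp (\<mu> * (s / (1 - c * s)) / (1 - C * (s / (1 - c * s)))))"
      using step[of "s / (1 - c * s)"] r s cs1 by simp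
    also have "1 - C * (s / (1 - c * s)) = (1 - (c + C) * s) / (1 - c * s)"
      using cs1 by (simp add: field_simps)
    also have "\<mu> * (s / (1 - c * s)) / ((1 - (c + C) * s) / (1 - c * s)) = \<mu> * s / (1 - (c + C) * s)"
      using cs1 by simp
    also have "c + C = c * \<mu>" using \<mu> by (simp add: c field_simps)
    also have "\<mu> * s / (1 - c * \<mu> * s) = l / (1 - c * l)" by (simp add: s)
    finally show ?case .
  qed simp
  moreover have "(generating_function Z ^^ m) a \<le> (generating_function Z ^^ m) b" if "a \<le> b" for a b
    using that by (induction m) (auto intro: generating_function_mono)
  moreover have "l / \<mu> ^ m \<le> (l / \<mu> ^ m) / (1 - c * (l / \<mu> ^ m))"
  proof -
    have "l / \<mu> ^ m \<le> l" using \<mu> l by (simp add: divide_le_eq mult_le_cancel_left1 one_le_power)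
    then have "c * (l / \<mu> ^ m) \<le> c * l" using c0 by (intro mult_left_mono) auto
    then have lt: "0 < 1 - c * (l / \<mu> ^ m)" using l by linarith
    have "0 \<le> c * (l / \<mu> ^ m)" "0 \<le> l / \<mu> ^ m" using c0 l \<mu> by auto
    then have "(l / \<mu> ^ m) * (1 - c * (l / \<mu> ^ m)) \<le> l / \<mu> ^ m"
      using mult_left_le[of "1 - c * (l / \<mu> ^ m)" "l / \<mu> ^ m"] by linarith
    with lt show ?thesis by (simp only: pos_le_divide_eq)
  qed
  ultimately show ?thesis by (meson ennreal_leI exp_le_cancel_iff order_trans)
qed

text \<open>The exponential moments of the normalized generation sizes are bounded uniformly, and Fatou's
lemma transfers the bound to the limit.\<close>

theorem gw_limit_exponential_moment:
  assumes W: "gw_limit Z W" and u: "0 < u" "integrable (measure_pmf Z) (\<lambda>k. exp (u * real k))"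
    and mean: "integrable (measure_pmf Z) real" "1 < pmf_mean Z"
  shows "\<exists>l>0. (\<integral>\<^sup>+\<xi>. ennreal (exp (l * W \<xi>)) \<partial>gw_space Z) < \<infinity>"
proof -
  let ?\<mu> = "pmf_mean Z"
  obtain r C where r: "0 < r" and C: "0 < C"
    and step: "\<And>v. 0 \<le> v \<Longrightarrow> v \<le> r \<Longrightarrow> C * v < 1 \<and>
      generating_function Z (ennreal (exp v)) \<le> ennreal (exp (?\<mu> * v / (1 - C * v)))"
    using generating_function_le_linear_fractional[OF u mean(1)] mean by auto
  define c where "c = C / (?\<mu> - 1)"
  have c: "0 < c" using C mean by (simp add: c_def)
  define l where "l = min (1 / (2 * c)) (r / 2)"
  have l: "0 < l" using c r by (simp add: l_def)
  have "c * l \<le> c * (1 / (2 * c))" using c by (intro mult_left_mono) (auto simp: l_def)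
  then have cl: "c * l \<le> 1 / 2" using c by simp
  have "l / (1 - c * l) \<le> (r / 2) / (1 / 2)"
    using cl l by (intro frac_le) (auto simp: l_def)
  then have lr: "l / (1 - c * l) \<le> r" by simp
  have [measurable]: "W \<in> borel_measurable (gw_space Z)" using W by (simp add: gw_limit_def)
  have [measurable]: "(\<lambda>\<xi>. a ^ gw_size \<xi> m) \<in> borel_measurable (gw_space Z)" for a :: ennreal and m
    by (rule measurable_compose[OF measurable_gw_size_gw_space]) simp
  let ?g = "\<lambda>m \<xi>. ennreal (exp (l / ?\<mu> ^ m)) ^ gw_size \<xi> m"
  have "(\<integral>\<^sup>+\<xi>. ennreal (exp (l * W \<xi>)) \<partial>gw_space Z) = (\<integral>\<^sup>+\<xi>. liminf (\<lambda>m. ?g m \<xi>) \<partial>gw_space Z)"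
  proof (intro nn_integral_cong_AE)
    show "AE \<xi> in gw_space Z. ennreal (exp (l * W \<xi>)) = liminf (\<lambda>m. ?g m \<xi>)"
      using tendsto_exp_gw_size[OF W, of l]
      by eventually_elim (rule lim_imp_Liminf[symmetric], auto)
  qed
  also have "\<dots> \<le> liminf (\<lambda>m. \<integral>\<^sup>+\<xi>. ?g m \<xi> \<partial>gw_space Z)"
    by (rule nn_integral_liminf) measurable
  also have "\<dots> \<le> ennreal (exp (l / (1 - c * l)))"
    unfolding nn_integral_power_gw_size using cl l lr mean
    by (intro order_trans[OF Liminf_le_Limsup Limsup_bounded] always_eventually allI
        gw_size_exponential_moment[OF refl _ C step c_def]) auto
  also have "\<dots> < \<infinity>" by simp
  finally show ?thesis using l by blast
qed

lemma power_fact_le_exp: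
  assumes "0 \<le> (y::real)"
  shows "y ^ q / fact q \<le> exp y"
proof -
  have "(\<Sum>n\<in>{q}. y ^ n /\<^sub>R fact n) \<le> (\<Sum>n. y ^ n /\<^sub>R fact n)"
    using assms by (intro sum_le_suminf summable_exp_generic) auto
  then show ?thesis by (simp add: exp_def divide_inverse mult.commute)
qed

theorem gw_limit_right_tail:
  assumes W: "gw_limit Z W" and u: "0 < u" "integrable (measure_pmf Z) (\<lambda>k. exp (u * real k))"
    and mean: "integrable (measure_pmf Z) real" "1 < pmf_mean Z"
  shows "\<exists>C\<ge>0. \<forall>v>0. \<P>(\<xi> in gw_space Z. v \<le> W \<xi>) \<le> C / v ^ q"
proof -
  interpret prob_space "gw_space Z" by (rule prob_space_gw_space)
  have [measurable]: "W \<in> borel_measurable (gw_space Z)" using W by (simp add: gw_limit_def)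
  obtain l where l: "0 < l" "(\<integral>\<^sup>+\<xi>. ennreal (exp (l * W \<xi>)) \<partial>gw_space Z) < \<infinity>"
    using gw_limit_exponential_moment[OF assms] by blast
  define E where "E = expectation (\<lambda>\<xi>. exp (l * W \<xi>))"
  have int: "integrable (gw_space Z) (\<lambda>\<xi>. exp (l * W \<xi>))"
    using l by (intro integrableI_bounded) auto
  have E: "0 \<le> E" unfolding E_def by (intro integral_nonneg_AE) auto
  have "\<P>(\<xi> in gw_space Z. v \<le> W \<xi>) \<le> (E * fact q / l ^ q) / v ^ q" if v: "0 < v" for v
  proof -
    have "{\<xi>\<in>space (gw_space Z). v \<le> W \<xi>} = {\<xi>\<in>space (gw_space Z). exp (l * v) \<le> exp (l * W \<xi>)}"
      using l by auto
    then have "\<P>(\<xi> in gw_space Z. v \<le> W \<xi>) \<le> E / exp (l * v)"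
      unfolding E_def using integral_Markov_inequality_measure[OF int, of UNIV "exp (l * v)"]
        sets.top[of "gw_space Z"] by simp
    also have "\<dots> \<le> E / ((l * v) ^ q / fact q)"
    proof -
      have "(l * v) ^ q / fact q \<le> exp (l * v)"
        using l v by (intro power_fact_le_exp) simp
      then show ?thesis using E l v by (intro divide_left_mono) auto
    qed
    also have "\<dots> = (E * fact q / l ^ q) / v ^ q" by (simp add: power_mult_distrib)
    finally show ?thesis .
  qed
  then show ?thesis using E l by (intro exI[of _ "E * fact q / l ^ q"]) auto
qed

section \<open>Exponential integrability of the offspring distribution\<close>

text \<open>Take \<open>c\<close> with \<open>\<P>(Z > c) \<le> 1 / 2\<close> and put \<open>b = c + \<zeta>\<close>. The tail condition with \<open>z = b\<close>
then says that the tail of \<open>Z\<close> is halved whenever its argument grows by \<open>b\<close>, so it decays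
geometrically.\<close>

lemma exponential_moment_of_tail:
  fixes Z :: "nat pmf"
  assumes mean: "integrable (measure_pmf Z) real"
    and "0 \<le> \<zeta>" and tail: "\<forall>z y :: real. 0 \<le> y \<and> \<P>(m in measure_pmf Z. real m > y) > 0 \<longrightarrow>
        \<P>(m in measure_pmf Z. real m - y > z \<bar> real m > y)
          \<le> \<P>(m in measure_pmf Z. real m + \<zeta> > z)"
  shows "\<exists>u>0. integrable (measure_pmf Z) (\<lambda>k. exp (u * real k))"
proof -
  define S where "S y = measure_pmf.prob Z {m. y < real m}" for y :: real
  define e where "e = measure_pmf.expectation Z real"
  define c where "c = 2 * e + 1"
  define b where "b = c + \<zeta>"
  have "0 \<le> e" unfolding e_def by (intro integral_nonneg_AE) auto
  then have c: "0 < c" "e / c \<le> 1 / 2"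
    by (auto simp: c_def field_simps)
  have b: "0 < b" using c \<open>0 \<le> \<zeta>\<close> by (simp add: b_def)
  have S_mono: "S z \<le> S y" if "y \<le> z" for y z
    unfolding S_def using that by (intro measure_pmf.finite_measure_mono) auto
  have "S c \<le> measure_pmf.prob Z {m. c \<le> real m}"
    unfolding S_def by (intro measure_pmf.finite_measure_mono) auto
  also have "\<dots> \<le> e / c"
    unfolding e_def using integral_Markov_inequality_measure[OF mean, of UNIV c] c by simp
  finally have Sc: "S c \<le> 1 / 2" using c by linarith
  have halve: "S (y + b) \<le> S y / 2" if y: "0 \<le> y" for y
  proof (cases "S y = 0")
    case True
    then show ?thesis using S_mono[of y "y + b"] b by simp
  next
    case False
    then have Sy: "0 < S y" unfolding S_def by (simp add: zero_less_measure_iff)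
    have "{m. b < real m - y \<and> y < real m} = {m. y + b < real m}" using b by auto
    moreover have "{m. b < real m + \<zeta>} = {m. c < real m}" by (auto simp: b_def)
    ultimately have "S (y + b) / S y \<le> S c"
      using tail[rule_format, of y b] y Sy by (simp add: S_def cond_prob_def)
    then have "S (y + b) / S y \<le> 1 / 2" using Sc by linarith
    then show ?thesis using Sy by (simp add: field_simps)
  qed
  have S_geometric: "S (real j * b) \<le> (1 / 2) ^ j" for j :: nat
  proof (induction j)
    case (Suc j)
    then show ?case using halve[of "real j * b"] b by (simp add: algebra_simps)
  qed (simp add: S_def)
  \<comment> \<open>Any growth factor below 2 per step \<open>b\<close> is beaten by the halving of the tail.\<close>
  define u where "u = ln (3 / 2) / b"
  have u: "0 < u" using b by (simp add: u_def)
  have exp_ub: "exp (u * (real j * b)) = (3 / 2) ^ j" for j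
    using b by (simp add: u_def exp_of_nat2_mult)
  let ?f = "\<lambda>k j. ennreal ((3 / 2) ^ Suc j) * indicator {m. real j * b < real m} k"
  \<comment> \<open>The summand 1 covers \<open>k = 0\<close>; any other \<open>k\<close> lies in an interval from \<open>j * b\<close> to
    \<open>(j + 1) * b\<close>.\<close>
  have pointwise: "ennreal (exp (u * real k)) \<le> 1 + (\<Sum>j. ?f k j)" for k
  proof (cases "k = 0")
    case False
    define j where "j = nat (\<lceil>real k / b\<rceil> - 1)"
    have "0 < real k / b" using False b by simp
    then have j: "real j = of_int \<lceil>real k / b\<rceil> - 1" by (simp add: j_def)
    have "real j < real k / b" using j by linarith
    moreover have "real k / b \<le> real (Suc j)" using j by simp
    ultimately have k: "real j * b < real k" "real k \<le> real (Suc j) * b"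
      using b by (simp_all add: field_simps)
    have "exp (u * real k) \<le> exp (u * (real (Suc j) * b))"
      using k u by (simp add: mult_left_mono)
    also have "\<dots> = (3 / 2) ^ Suc j" by (rule exp_ub)
    finally have "ennreal (exp (u * real k)) \<le> ?f k j"
      using k by (simp add: ennreal_leI del: power_Suc)
    also have "\<dots> \<le> (\<Sum>j. ?f k j)"
    proof -
      have "(\<Sum>i\<in>{j}. ?f k i) \<le> (\<Sum>i. ?f k i)" by (intro sum_le_suminf) (auto simp: summableI)
      then show ?thesis by (simp only: sum.insert finite.emptyI empty_iff not_False_eq_True sum.empty add_0_right)
    qed
    finally show ?thesis by (simp add: add_increasing)
  qed simp
  have "(\<integral>\<^sup>+k. ennreal (exp (u * real k)) \<partial>measure_pmf Z) \<le> (\<integral>\<^sup>+k. 1 + (\<Sum>j. ?f k j) \<partial>measure_pmf Z)"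
    by (intro nn_integral_mono pointwise)
  also have "\<dots> = 1 + (\<Sum>j. \<integral>\<^sup>+k. ?f k j \<partial>measure_pmf Z)"
    by (simp add: nn_integral_add nn_integral_suminf)
  also have "\<dots> = 1 + (\<Sum>j. ennreal ((3 / 2) ^ Suc j * S (real j * b)))"
    by (simp add: nn_integral_cmult S_def measure_pmf.emeasure_eq_measure flip: ennreal_mult del: power_Suc)
  also have "\<dots> \<le> 1 + (\<Sum>j. ennreal (3 / 2 * (3 / 4) ^ j))"
  proof (intro add_mono order_refl suminf_le ennreal_leI)
    fix j :: nat
    have "(3 / 2) ^ Suc j * S (real j * b) \<le> (3 / 2) ^ Suc j * (1 / 2) ^ j"
      by (intro mult_left_mono S_geometric) simp
    also have "\<dots> = 3 / 2 * (3 / 4) ^ j" by (simp flip: power_mult_distrib)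
    finally show "(3 / 2) ^ Suc j * S (real j * b) \<le> 3 / 2 * (3 / 4) ^ j" .
  qed (auto simp: summableI)
  also have "\<dots> < \<infinity>"
  proof -
    have "summable (\<lambda>j::nat. 3 / 2 * (3 / 4 :: real) ^ j)" by (intro summable_mult summable_geometric) simp
    then show ?thesis by (simp add: suminf_ennreal2 ennreal_add_less_top)
  qed
  finally show ?thesis using u by (intro exI[of _ u] conjI integrableI_bounded) auto
qed

section \<open>Durations of crossings\<close>

text \<open>Round the random time up to multiples of \<open>1 / (m + 1)\<close>. The rounded times take countably many
values, and by continuity the values of the path converge.\<close>

lemma (in crossing_process) measurable_at_random_time:
  assumes [measurable]: "T \<in> borel_measurable M" and T: "\<And>\<omega>. 0 \<le> T \<omega>"
  shows "(\<lambda>\<omega>. X (T \<omega>) \<omega>) \<in> borel_measurable M"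
proof (rule borel_measurable_LIMSEQ_real)
  let ?N = "\<lambda>m \<omega>. nat \<lceil>real (Suc m) * T \<omega>\<rceil>"
  show "(\<lambda>m. X (real (?N m \<omega>) / real (Suc m)) \<omega>) \<longlonglongrightarrow> X (T \<omega>) \<omega>" if "\<omega> \<in> space M" for \<omega>
  proof (rule continuous_on_tendsto_compose[OF continuous_paths[OF that]])
    have N: "T \<omega> \<le> real (?N m \<omega>) / real (Suc m)" "real (?N m \<omega>) / real (Suc m) \<le> T \<omega> + 1 / real (Suc m)" for m
    proof -
      have "0 \<le> real (Suc m) * T \<omega>" using T by simp
      then have "real (Suc m) * T \<omega> \<le> real (?N m \<omega>)" "real (?N m \<omega>) \<le> real (Suc m) * T \<omega> + 1"
        by linarith+
      then show "T \<omega> \<le> real (?N m \<omega>) / real (Suc m)"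
          "real (?N m \<omega>) / real (Suc m) \<le> T \<omega> + 1 / real (Suc m)"
        by (simp_all add: field_simps del: of_nat_Suc)
    qed
    have "(\<lambda>m. T \<omega> + 1 / real (Suc m)) \<longlonglongrightarrow> T \<omega> + 0"
      by (intro tendsto_add tendsto_const LIMSEQ_Suc[OF lim_1_over_n])
    then have lim: "(\<lambda>m. T \<omega> + 1 / real (Suc m)) \<longlonglongrightarrow> T \<omega>" by (simp only: add_0_right)
    show "(\<lambda>m. real (?N m \<omega>) / real (Suc m)) \<longlonglongrightarrow> T \<omega>"
      by (rule tendsto_sandwich[OF always_eventually always_eventually tendsto_const lim])
         (use N in blast)+
    show "\<forall>\<^sub>F m in sequentially. real (?N m \<omega>) / real (Suc m) \<in> {0..}"
      by (intro always_eventually allI) simp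
  qed (use T in simp)
  show "(\<lambda>\<omega>. X (real (?N m \<omega>) / real (Suc m)) \<omega>) \<in> borel_measurable M" for m
  proof (rule measurable_compose_countable[where f="\<lambda>j \<omega>. X (real j / real (Suc m)) \<omega>"])
    show "?N m \<in> measurable M (count_space UNIV)" by measurable
  qed (auto intro: random_variable_X)
qed

context canonical_embedded_branching_process
begin

lemma measurable_duration: "1 \<le> k \<Longrightarrow> D n k \<in> borel_measurable M"
  using D_cond_indep[of n] by (simp add: cond_indep_vars_def)

lemma measurable_passage: "(\<lambda>\<omega>. passage (\<lambda>t. X t \<omega>) n k) \<in> borel_measurable M"
proof (induction k)
  case (Suc k)
  have "(\<lambda>\<omega>. passage (\<lambda>t. X t \<omega>) n (Suc k)) = (\<lambda>\<omega>. passage (\<lambda>t. X t \<omega>) n k + D n (Suc k) \<omega>)"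
    by (simp add: duration_Suc del: passage.simps)
  then show ?case using Suc measurable_duration[of "Suc k" n] by simp
qed simp

text \<open>A conditional probability given a set that is not measurable would be 0 by convention, so the
hypotheses on the laws given an orientation are informative only because of this lemma. The passage
times are sums of durations and therefore measurable.\<close>

lemma measurable_orientation: "{\<omega>\<in>space M. \<alpha> n k \<omega> = i} \<in> sets M"
proof -
  note [measurable] = measurable_at_random_time[OF measurable_passage passage_nonneg]
  have "{\<omega>\<in>space M. \<alpha> n k \<omega>} \<in> sets M"
    unfolding orientation_def by measurable
  moreover have "{\<omega>\<in>space M. \<not> \<alpha> n k \<omega>} = space M - {\<omega>\<in>space M. \<alpha> n k \<omega>}"
    by blast
  ultimately show ?thesis by (cases i) (simp_all add: sets.compl_sets)
qed

text \<open>The law of a duration is the same for both values of the orientation, so it is also the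
unconditional law.\<close>

lemma duration_law:
  "\<exists>W. gw_limit Z W \<and> (\<forall>n k B. 1 \<le> k \<and> B \<in> sets borel \<longrightarrow>
    \<P>(\<omega> in M. D n k \<omega> \<in> B) = \<P>(\<xi> in gw_space Z. pmf_mean Z powi n * W \<xi> \<in> B))"
proof -
  obtain W where W: "gw_limit Z W" and law:
    "\<forall>n k i B. 1 \<le> k \<and> \<P>(\<omega> in M. \<alpha> n k \<omega> = i) > 0 \<and> B \<in> sets borel \<longrightarrow>
      \<P>(\<omega> in M. D n k \<omega> \<in> B \<bar> \<alpha> n k \<omega> = i) = \<P>(\<xi> in gw_space Z. pmf_mean Z powi n * W \<xi> \<in> B)"
    using D_cond_distributed by (elim exE conjE) (rule that)
  have "\<P>(\<omega> in M. D n k \<omega> \<in> B) = \<P>(\<xi> in gw_space Z. pmf_mean Z powi n * W \<xi> \<in> B)"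
    if k: "1 \<le> k" and B: "B \<in> sets borel" for n k B
  proof -
    let ?w = "\<P>(\<xi> in gw_space Z. pmf_mean Z powi n * W \<xi> \<in> B)"
    let ?O = "\<lambda>i. {\<omega>\<in>space M. \<alpha> n k \<omega> = i}"
    have [measurable]: "?O i \<in> sets M" for i by (rule measurable_orientation)
    have DB: "{\<omega>\<in>space M. D n k \<omega> \<in> B} \<in> sets M"
      using measurable_duration[OF k, of n] B by measurable
    have part: "\<P>(\<omega> in M. D n k \<omega> \<in> B \<and> \<alpha> n k \<omega> = i) = ?w * prob (?O i)" for i
    proof (cases "prob (?O i) = 0")
      case True
      have "\<P>(\<omega> in M. D n k \<omega> \<in> B \<and> \<alpha> n k \<omega> = i) \<le> prob (?O i)"
        by (intro finite_measure_mono) auto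
      with True show ?thesis by (simp add: measure_le_0_iff)
    next
      case False
      then have "0 < prob (?O i)" by (simp add: zero_less_measure_iff)
      with law[rule_format, of k n i B] k B show ?thesis by (simp add: cond_prob_def field_simps)
    qed
    have split: "prob E = prob (E \<inter> ?O True) + prob (E \<inter> ?O False)" if "E \<in> sets M" for E
    proof -
      have "E = (E \<inter> ?O True) \<union> (E \<inter> ?O False)" using sets.sets_into_space[OF that] by blast
      then have "prob E = prob ((E \<inter> ?O True) \<union> (E \<inter> ?O False))" by (rule arg_cong)
      also have "\<dots> = prob (E \<inter> ?O True) + prob (E \<inter> ?O False)"
        by (intro finite_measure_Union sets.Int that measurable_orientation) blast
      finally show ?thesis .
    qed
    have "\<P>(\<omega> in M. D n k \<omega> \<in> B) = ?w * prob (?O True) + ?w * prob (?O False)"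
      unfolding part[symmetric] by (subst split[OF DB]) (auto intro!: arg_cong2[where f="(+)"] arg_cong[where f=prob])
    also have "\<dots> = ?w * (prob (space M \<inter> ?O True) + prob (space M \<inter> ?O False))"
    proof -
      have "prob (space M \<inter> ?O i) = prob (?O i)" for i by (rule arg_cong[where f=prob]) blast
      then show ?thesis by (simp only: distrib_left)
    qed
    also have "\<dots> = ?w" by (subst split[symmetric]) (auto simp: prob_space)
    finally show ?thesis .
  qed
  with W show ?thesis by (intro exI[of _ W]) simp
qed

lemma AE_regular_paths:
  "AE \<omega> in M. continuous_on {0..} (\<lambda>t. X t \<omega>) \<and> X 0 \<omega> = 0 \<and>
     (\<forall>n k. next_hits (\<lambda>t. X t \<omega>) n (passage (\<lambda>t. X t \<omega>) n k) \<noteq> {})"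
  using passage_times_finite
  by (rule AE_mp) (auto intro!: AE_I2 continuous_paths starts_at_0)

text \<open>Positivity of the limit variable, needed for its left tail, is inherited from the crossing
number 1 of level 0: its duration has the law of the limit variable and is positive.\<close>

lemma duration_tails:
  assumes Z: "set_pmf Z \<subseteq> {k. 2 \<le> k}" and mean: "integrable (measure_pmf Z) real" "1 < pmf_mean Z"
    and u: "0 < u" "integrable (measure_pmf Z) (\<lambda>k. exp (u * real k))"
  shows "\<exists>C\<ge>0. \<forall>n k v. 1 \<le> k \<and> 0 < v \<longrightarrow>
    \<P>(\<omega> in M. D n k \<omega> \<le> pmf_mean Z powi n * v) \<le> C * v ^ q \<and>
    \<P>(\<omega> in M. pmf_mean Z powi n * v \<le> D n k \<omega>) \<le> C / v ^ q"
proof -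
  let ?\<mu> = "pmf_mean Z"
  obtain W where W: "gw_limit Z W" and law': "\<forall>n k B. 1 \<le> k \<and> B \<in> sets borel \<longrightarrow>
    \<P>(\<omega> in M. D n k \<omega> \<in> B) = \<P>(\<xi> in gw_space Z. ?\<mu> powi n * W \<xi> \<in> B)"
    using duration_law by (elim exE conjE) (rule that)
  have law: "\<P>(\<omega> in M. D n k \<omega> \<in> B) = \<P>(\<xi> in gw_space Z. ?\<mu> powi n * W \<xi> \<in> B)"
    if "1 \<le> k" "B \<in> sets borel" for n k B
    using law'[rule_format, OF conjI[OF that]] .
  interpret G: prob_space "gw_space Z" by (rule prob_space_gw_space)
  have [measurable]: "W \<in> borel_measurable (gw_space Z)" using W by (simp add: gw_limit_def)
  have "AE \<omega> in M. D 0 1 \<omega> \<in> {0<..}"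
    using AE_regular_paths by eventually_elim (auto intro!: duration_pos)
  then have "\<P>(\<omega> in M. D 0 1 \<omega> \<in> {0<..}) = 1"
    using measurable_duration[of 1 0] by (intro prob_eq_1[THEN iffD2]) auto
  then have "\<P>(\<xi> in gw_space Z. 0 < W \<xi>) = 1" using law[of 1 "{0<..}" 0] by simp
  moreover have "{\<xi>\<in>space (gw_space Z). 0 < W \<xi>} \<in> sets (gw_space Z)" by measurable
  ultimately have pos: "AE \<xi> in gw_space Z. 0 < W \<xi>"
    using G.prob_Collect_eq_1[of "\<lambda>\<xi>. 0 < W \<xi>"] by simp
  obtain C1 where C1: "0 \<le> C1" "\<And>v. 0 < v \<Longrightarrow> \<P>(\<xi> in gw_space Z. W \<xi> \<le> v) \<le> C1 * v ^ q"
    using gw_limit_left_tail[OF W Z mean(2) pos, of q] by (elim exE conjE) (rule that, auto)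
  obtain C2 where C2: "0 \<le> C2" "\<And>v. 0 < v \<Longrightarrow> \<P>(\<xi> in gw_space Z. v \<le> W \<xi>) \<le> C2 / v ^ q"
    using gw_limit_right_tail[OF W u mean, of q] by (elim exE conjE) (rule that, auto)
  have "\<P>(\<omega> in M. D n k \<omega> \<le> ?\<mu> powi n * v) \<le> (C1 + C2) * v ^ q \<and>
    \<P>(\<omega> in M. ?\<mu> powi n * v \<le> D n k \<omega>) \<le> (C1 + C2) / v ^ q" if "1 \<le> k" "0 < v" for n k v
  proof
    have "0 < ?\<mu> powi n" using mean by simp
    then have scale: "?\<mu> powi n * W \<xi> \<le> ?\<mu> powi n * v \<longleftrightarrow> W \<xi> \<le> v"
      "?\<mu> powi n * v \<le> ?\<mu> powi n * W \<xi> \<longleftrightarrow> v \<le> W \<xi>" for \<xi>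
      by simp_all
    have "\<P>(\<omega> in M. D n k \<omega> \<le> ?\<mu> powi n * v) = \<P>(\<xi> in gw_space Z. W \<xi> \<le> v)"
      using law[OF that(1), of "{..?\<mu> powi n * v}" n] scale by simp
    also have "\<dots> \<le> C1 * v ^ q" using C1 that by simp
    also have "\<dots> \<le> (C1 + C2) * v ^ q" using C2 that by (intro mult_right_mono) auto
    finally show "\<P>(\<omega> in M. D n k \<omega> \<le> ?\<mu> powi n * v) \<le> (C1 + C2) * v ^ q" .
    have "\<P>(\<omega> in M. ?\<mu> powi n * v \<le> D n k \<omega>) = \<P>(\<xi> in gw_space Z. v \<le> W \<xi>)"
      using law[OF that(1), of "{?\<mu> powi n * v..}" n] scale by simp
    also have "\<dots> \<le> C2 / v ^ q" using C2 that by simp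
    also have "\<dots> \<le> (C1 + C2) / v ^ q" using C1 that by (intro divide_right_mono) auto
    finally show "\<P>(\<omega> in M. ?\<mu> powi n * v \<le> D n k \<omega>) \<le> (C1 + C2) / v ^ q" .
  qed
  then show ?thesis using C1 C2 by (intro exI[of _ "C1 + C2"]) auto
qed

text \<open>With tails of order \<open>3 * d\<close>, a duration of level \<open>-n\<close> deviates by the factor
\<open>\<mu> powr (n / d)\<close> with probability of order \<open>1 / \<mu> ^ (3 * n)\<close>. This beats the number
\<open>\<mu> ^ (2 * n)\<close> of crossings and leaves a summable \<open>1 / \<mu> ^ n\<close>.\<close>

lemma AE_regular_durations:
  fixes d :: nat
  assumes Z: "set_pmf Z \<subseteq> {k. 2 \<le> k}" and mean: "integrable (measure_pmf Z) real" "1 < pmf_mean Z"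
    and u: "0 < u" "integrable (measure_pmf Z) (\<lambda>k. exp (u * real k))" and d: "1 \<le> d"
  shows "AE \<omega> in M. \<forall>\<^sub>F n in sequentially. \<forall>k\<in>{1..Suc (nat \<lceil>pmf_mean Z ^ (2 * n)\<rceil>)}.
        pmf_mean Z powr (- (1 + 1 / real d) * real n) \<le> D (- int n) k \<omega> \<and>
        D (- int n) k \<omega> \<le> pmf_mean Z powr (- (1 - 1 / real d) * real n)"
proof -
  let ?\<mu> = "pmf_mean Z"
  let ?K = "\<lambda>n. Suc (nat \<lceil>?\<mu> ^ (2 * n)\<rceil>)"
  define v where "v n = ?\<mu> powr (- (1 / real d) * real n)" for n
  have v: "0 < v n" for n using mean by (simp add: v_def)
  have v_power: "v n ^ (3 * d) = 1 / ?\<mu> ^ (3 * n)" for n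
  proof -
    have "v n ^ (3 * d) = ?\<mu> powr (- real (3 * n))"
      using mean d by (simp add: v_def powr_power)
    also have "\<dots> = inverse (?\<mu> ^ (3 * n))"
      using mean powr_realpow[of ?\<mu> "3 * n"] by (simp add: powr_minus del: of_nat_mult)
    finally show ?thesis by (simp add: inverse_eq_divide)
  qed
  have powi: "?\<mu> powi (- int n) = ?\<mu> powr (- real n)" for n
    using mean by (simp add: powr_minus power_int_minus powr_realpow)
  have lo: "?\<mu> powr (- (1 + 1 / real d) * real n) = ?\<mu> powi (- int n) * v n" for n
    by (simp add: powi v_def algebra_simps flip: powr_add)
  have hi: "?\<mu> powr (- (1 - 1 / real d) * real n) = ?\<mu> powi (- int n) * (1 / v n)" for n
    using mean by (simp add: powi v_def algebra_simps powr_minus_divide flip: powr_add powr_diff)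
  obtain C where C: "0 \<le> C" and tails: "\<And>n k v. 1 \<le> k \<Longrightarrow> 0 < v \<Longrightarrow>
    \<P>(\<omega> in M. D n k \<omega> \<le> ?\<mu> powi n * v) \<le> C * v ^ (3 * d) \<and>
    \<P>(\<omega> in M. ?\<mu> powi n * v \<le> D n k \<omega>) \<le> C / v ^ (3 * d)"
    using duration_tails[OF Z mean u, of "3 * d"] by (elim exE conjE) (rule that, auto)
  define short where "short n k = {\<omega>\<in>space M. D (- int n) k \<omega> \<le> ?\<mu> powi (- int n) * v n}" for n k
  define long where "long n k = {\<omega>\<in>space M. ?\<mu> powi (- int n) * (1 / v n) \<le> D (- int n) k \<omega>}" for n k
  define bad where "bad n = (\<Union>k\<in>{1..?K n}. short n k \<union> long n k)" for n
  have meas: "short n k \<in> sets M" "long n k \<in> sets M" if "1 \<le> k" for n k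
    using measurable_duration[OF that, of "- int n"] unfolding short_def long_def by measurable
  have bad_prob: "prob (bad n) \<le> 6 * C * (1 / ?\<mu>) ^ n" for n
  proof -
    have "prob (bad n) \<le> (\<Sum>k\<in>{1..?K n}. prob (short n k \<union> long n k))"
      unfolding bad_def using meas by (intro finite_measure_subadditive_finite) auto
    also have "\<dots> \<le> (\<Sum>k\<in>{1..?K n}. 2 * C / ?\<mu> ^ (3 * n))"
    proof (intro sum_mono)
      fix k assume "k \<in> {1..?K n}"
      then have k: "1 \<le> k" by simp
      have "prob (short n k) \<le> C / ?\<mu> ^ (3 * n)"
        using tails[OF k v[of n], of "- int n"] by (simp add: short_def v_power)
      moreover have "prob (long n k) \<le> C / ?\<mu> ^ (3 * n)"
        using tails[OF k, of "1 / v n" "- int n"] v[of n] by (simp add: long_def power_one_over v_power)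
      moreover have "prob (short n k \<union> long n k) \<le> prob (short n k) + prob (long n k)"
        using meas[OF k] by (intro measure_Un_le)
      ultimately show "prob (short n k \<union> long n k) \<le> 2 * C / ?\<mu> ^ (3 * n)" by simp
    qed
    also have "\<dots> = real (?K n) * (2 * C / ?\<mu> ^ (3 * n))" by simp
    also have "\<dots> \<le> (3 * ?\<mu> ^ (2 * n)) * (2 * C / ?\<mu> ^ (3 * n))"
    proof (intro mult_right_mono)
      have "1 \<le> ?\<mu> ^ (2 * n)" using mean by (intro one_le_power) simp
      then show "real (?K n) \<le> 3 * ?\<mu> ^ (2 * n)" by simp linarith
    qed (use C mean in auto)
    also have "?\<mu> ^ (3 * n) = ?\<mu> ^ (2 * n) * ?\<mu> ^ n" by (simp flip: power_add)
    also have "(3 * ?\<mu> ^ (2 * n)) * (2 * C / (?\<mu> ^ (2 * n) * ?\<mu> ^ n)) = 6 * C * (1 / ?\<mu>) ^ n"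
      using mean by (simp add: power_divide)
    finally show ?thesis .
  qed
  have "AE \<omega> in M. \<forall>\<^sub>F n in sequentially. \<omega> \<in> space M - bad n"
  proof (rule borel_cantelli_AE1)
    show "bad n \<in> sets M" for n unfolding bad_def using meas by (intro sets.finite_UN) auto
    show "summable (\<lambda>n. prob (bad n))"
    proof (rule summable_comparison_test')
      show "summable (\<lambda>n. 6 * C * (1 / ?\<mu>) ^ n)"
        using mean by (intro summable_mult summable_geometric) simp
    qed (use bad_prob in auto)
  qed (simp add: emeasure_eq_measure)
  then show ?thesis
  proof eventually_elim
    case (elim \<omega>)
    then show ?case
      unfolding lo hi
      by eventually_elim (auto simp: bad_def short_def long_def not_le less_imp_le)
  qed
qed

end

section \<open>Monofractality\<close>

theorem corollary1:
  fixes Z :: "nat pmf"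
    and M :: "'a measure"
    and X :: "real \<Rightarrow> 'a \<Rightarrow> real"
    and \<mu> H :: real
  assumes Z_values: "set_pmf Z \<subseteq> {m. even m \<and> 2 \<le> m}"
    and mean_finite: "integrable (measure_pmf Z) real"
    and \<mu>_def: "\<mu> = measure_pmf.expectation Z real"
    and mean_gt_2: "2 < \<mu>"
    and Z_log_Z: "integrable (measure_pmf Z) (\<lambda>m. real m * ln (real m))"
    and tail: "\<exists>\<zeta>\<ge>0. \<forall>z y :: real. 0 \<le> y \<and> \<P>(m in measure_pmf Z. real m > y) > 0 \<longrightarrow>
        \<P>(m in measure_pmf Z. real m - y > z \<bar> real m > y)
          \<le> \<P>(m in measure_pmf Z. real m + \<zeta> > z)"
    and cebp: "canonical_embedded_branching_process M X Z"
    and H_def: "H = ln 2 / ln \<mu>"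
  shows "AE \<omega> in M. \<forall>t\<in>{0..1}. local_holder_exponent (\<lambda>t. X t \<omega>) t = ereal H"
proof -
  interpret canonical_embedded_branching_process M X Z by (rule cebp)
  obtain u where u: "0 < u" "integrable (measure_pmf Z) (\<lambda>k. exp (u * real k))"
    using tail exponential_moment_of_tail[OF mean_finite] by blast
  have \<mu>: "\<mu> = pmf_mean Z" "1 < \<mu>" using \<mu>_def mean_gt_2 by (simp_all add: pmf_mean_def)
  have Z: "set_pmf Z \<subseteq> {k. 2 \<le> k}" using Z_values by auto
  have "AE \<omega> in M. \<forall>d\<in>{2::nat..}. \<forall>\<^sub>F n in sequentially. \<forall>k\<in>{1..Suc (nat \<lceil>\<mu> ^ (2 * n)\<rceil>)}.
        \<mu> powr (- (1 + 1 / real d) * real n) \<le> D (- int n) k \<omega> \<and>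
        D (- int n) k \<omega> \<le> \<mu> powr (- (1 - 1 / real d) * real n)"
    using AE_regular_durations[OF Z mean_finite _ u] \<mu> by (intro AE_ball_countable[THEN iffD2]) auto
  then show ?thesis
    using AE_regular_paths
  proof eventually_elim
    case (elim \<omega>)
    then show ?case
      unfolding H_def by (intro ballI local_holder_exponent_of_regular_durations \<mu>) auto
  qed
qed

end
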